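(* Let $\Gamma=K_{n,n}$ or $\Gamma=K_{n,n}-nK_2$ and let $G\leqslant \mathrm{Aut}(\Gamma)$ be such that $G^+$ is one of the groups in the following list. Then $D(G)$ takes the corresponding value: \begin{itemize} \item $\Gamma=K_{n,n}$, $G^+=\mathrm{Alt}(n)\times\mathrm{Alt}(n)$: $D(G)=n-1$; \item $\Gamma=K_{n,n}$, $G^+=\langle \mathrm{Alt}(n)\times\mathrm{Alt}(n),((1,2),(1,2))\rangle$: $D(G)=n$; \item $\Gamma=K_{n,n}$, $G^+=\mathrm{Sym}(n)\times\mathrm{Sym}(n)$: $D(G)=n+1$; \item $\Gamma=K_{n,n}-nK_2$, $G^+=\mathrm{Diag}(\mathrm{Sym}(n)\times\mathrm{Sym}(n))$: $D(G)=\lfloor\sqrt{n}\rfloor+1$; \item $\Gamma=K_{n,n}-nK_2$, $G^+=\mathrm{Diag}(\mathrm{Alt}(n)\times\mathrm{Alt}(n))$: $D(G)=\lceil\sqrt{n-1}\rceil$; \item $\Gamma=K_{6,6}$, $G^+=\mathrm{Diag}_\varphi(H\times H)$ with $H=\mathrm{Alt}(6)$ or $\mathrm{Sym}(6)$: $D(G)=3$; \item $\Gamma=K_{4,4}$, $G^+=\langle V_4\times V_4,\mathrm{Diag}(H\times H)\rangle$ with $H=\mathrm{Alt}(4)$ or $\mathrm{Sym}(4)$: $D(G)=3$. \end{itemize}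
   Context: For a group $G$ acting on a set $\Omega$, the distinguishing number $D(G)$ is the smallest $k$ such that there is a partition $\{P_1,\dots,P_k\}$ of $\Omega$ with $\bigcap_i G_{P_i}=1$. $\Gamma$ is bipartite with parts $\Delta=\{v_1,\dots,v_n\}$ and $\Delta'=\{u_1,\dots,u_n\}$; $K_{n,n}-nK_2$ is the crown graph obtained from $K_{n,n}$ by deleting the perfect matching $\{v_i,u_i\}$. An element $(g,g')\in\mathrm{Sym}(n)\times\mathrm{Sym}(n)$ acts by $v_i\mapsto v_{i^g}$, $u_i\mapsto u_{i^{g'}}$, and $\tau$ is the involution $v_i\leftrightarrow u_i$, so $\mathrm{Aut}(\Gamma)\leqslant(\mathrm{Sym}(n)\times\mathrm{Sym}(n))\rtimes\langle\tau\rangle$. $G^+$ denotes the index-two subgroup of $G$ preserving each part of the bipartition. For $H\leqslant\mathrm{Sym}(n)$ and $\varphi\in\mathrm{Aut}(H)$, $\mathrm{Diag}_\varphi(H\times H)=\{(h,h^\varphi):h\in H\}$, and $\mathrm{Diag}(H\times H)$ is this with $\varphi$ trivial. In the $K_{6,6}$ case, $\varphi$ is a chosen outer automorphism of $\mathrm{Sym}(6)$ of order $2$. $V_4$ is the Klein four-group (normal in $\mathrm{Sym}(4)$).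
   Formalization: The items G^+=Alt(n)×Alt(n) and G^+=Diag(Alt(n)×Alt(n)) are stated for n≥3, since for n=1,2 G^+ is trivial, |G|=2 and D(G)=2, contrary to the formulas; the item with ((1,2),(1,2)) is stated for n≥2, where (1,2) exists. *)

theory Defs
  imports "HOL-Algebra.Sym_Groups" "HOL-Algebra.Bij" "HOL-Algebra.Multiplicative_Group" "HOL-Library.Disjoint_Sets" Complex_Main
begin

section \<open>Distinguishing number\<close>

definition distinguishing_partition :: "'a set \<Rightarrow> ('a \<Rightarrow> 'a) set \<Rightarrow> 'a set set \<Rightarrow> bool" where
  "distinguishing_partition \<Omega> G P \<longleftrightarrow>
     partition_on \<Omega> P \<and> {g \<in> G. \<forall>B\<in>P. g ` B = B} = {id}"

text \<open>For finite \<open>\<Omega>\<close> and \<open>G\<close> a group of permutations of \<open>\<Omega>\<close>, the partition into singletons is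
  distinguishing, so the minimum below is attained.\<close>

definition distinguishing_number :: "'a set \<Rightarrow> ('a \<Rightarrow> 'a) set \<Rightarrow> nat" where
  "distinguishing_number \<Omega> G =
     (LEAST k. \<exists>P. finite P \<and> card P = k \<and> distinguishing_partition \<Omega> G P)"


section \<open>The graphs and their automorphism groups\<close>

record 'a sgraph =
  verts :: "'a set"
  edges :: "'a set set"

text \<open>Automorphisms are permutations of the whole type fixing every point outside the vertex set,
  the same convention as for \<^const>\<open>sym_group\<close>.\<close>

definition Aut :: "'a sgraph \<Rightarrow> ('a \<Rightarrow> 'a) monoid" where
  "Aut \<Gamma> = \<lparr> carrier = {p. p permutes verts \<Gamma> \<and>
                 (\<forall>x\<in>verts \<Gamma>. \<forall>y\<in>verts \<Gamma>. {p x, p y} \<in> edges \<Gamma> \<longleftrightarrow> {x, y} \<in> edges \<Gamma>)},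
             mult = (\<circ>), one = id \<rparr>"

text \<open>The vertex \<open>v\<^sub>i\<close> is \<open>Inl i\<close> and \<open>u\<^sub>i\<close> is \<open>Inr i\<close>, for \<open>i \<in> {1..n}\<close>.\<close>

definition left_part :: "nat \<Rightarrow> (nat + nat) set" where
  "left_part n = Inl ` {1..n}"

definition right_part :: "nat \<Rightarrow> (nat + nat) set" where
  "right_part n = Inr ` {1..n}"

definition complete_bipartite :: "nat \<Rightarrow> (nat + nat) sgraph" where
  "complete_bipartite n =
     \<lparr> verts = left_part n \<union> right_part n,
       edges = {{Inl i, Inr j} | i j. i \<in> {1..n} \<and> j \<in> {1..n}} \<rparr>"

definition crown :: "nat \<Rightarrow> (nat + nat) sgraph" where
  "crown n =
     \<lparr> verts = verts (complete_bipartite n),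
       edges = edges (complete_bipartite n) - {{Inl i, Inr i} | i. i \<in> {1..n}} \<rparr>"

text \<open>The group \<open>G\<^sup>+\<close>.\<close>

definition part_preserving :: "nat \<Rightarrow> (nat + nat \<Rightarrow> nat + nat) set \<Rightarrow> (nat + nat \<Rightarrow> nat + nat) set" where
  "part_preserving n G =
     {g \<in> G. g ` left_part n = left_part n \<and> g ` right_part n = right_part n}"


section \<open>Subgroups of \<open>Sym(n) \<times> Sym(n)\<close>\<close>

text \<open>\<open>(g, g')\<close> sends \<open>v\<^sub>i\<close> to \<open>v\<^bsub>g i\<^esub>\<close> and \<open>u\<^sub>i\<close> to \<open>u\<^bsub>g' i\<^esub>\<close>. Permutations compose from right to left
  here; passing to the opposite convention changes none of the subgroups below.\<close>

definition bip_perm :: "(nat \<Rightarrow> nat) \<times> (nat \<Rightarrow> nat) \<Rightarrow> nat + nat \<Rightarrow> nat + nat" where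
  "bip_perm = (\<lambda>(g, g'). map_sum g g')"

abbreviation Sym :: "nat \<Rightarrow> (nat \<Rightarrow> nat) set" where
  "Sym n \<equiv> carrier (sym_group n)"

abbreviation Alt :: "nat \<Rightarrow> (nat \<Rightarrow> nat) set" where
  "Alt n \<equiv> carrier (alt_group n)"

definition gen_in_SymSym :: "nat \<Rightarrow> ((nat \<Rightarrow> nat) \<times> (nat \<Rightarrow> nat)) set \<Rightarrow> ((nat \<Rightarrow> nat) \<times> (nat \<Rightarrow> nat)) set" where
  "gen_in_SymSym n X = generate (DirProd (sym_group n) (sym_group n)) X"

definition Diag_twisted :: "('a \<Rightarrow> 'a) \<Rightarrow> 'a set \<Rightarrow> ('a \<times> 'a) set" where
  "Diag_twisted \<phi> H = {(h, \<phi> h) | h. h \<in> H}"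

abbreviation Diag :: "'a set \<Rightarrow> ('a \<times> 'a) set" where
  "Diag \<equiv> Diag_twisted id"

definition Klein4 :: "(nat \<Rightarrow> nat) set" where
  "Klein4 = {id, transpose 1 2 \<circ> transpose 3 4,
                 transpose 1 3 \<circ> transpose 2 4,
                 transpose 1 4 \<circ> transpose 2 3}"

definition inner_auts :: "('a, 'b) monoid_scheme \<Rightarrow> ('a \<Rightarrow> 'a) set" where
  "inner_auts G = {\<lambda>x\<in>carrier G. c \<otimes>\<^bsub>G\<^esub> x \<otimes>\<^bsub>G\<^esub> inv\<^bsub>G\<^esub> c | c. c \<in> carrier G}"

definition outer_involution :: "('a, 'b) monoid_scheme \<Rightarrow> ('a \<Rightarrow> 'a) \<Rightarrow> bool" where
  "outer_involution G \<phi> \<longleftrightarrow>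
     \<phi> \<in> auto G \<and> \<phi> \<notin> inner_auts G \<and> group.ord (AutoGroup G) \<phi> = 2"

end

theory Submission
  imports Defs
begin

text \<open>A partition is a colouring of the vertices, and \<open>G\<close> is generated by \<open>G\<^sup>+\<close> and any element that
  interchanges the two parts. Such an element preserves no colouring in which some colour occurs with
  different frequencies in the two parts, so for the upper bounds on \<open>K\<^bsub>n,n\<^esub>\<close> it suffices to find
  one such colouring whose stabiliser in \<open>G\<^sup>+\<close> is trivial. For the crown graph a colouring assigns to
  each \<open>i\<close> the pair of colours of \<open>v\<^sub>i\<close> and \<open>u\<^sub>i\<close>, and the elements interchanging the parts also
  interchange the components of these pairs. The lower bounds come from the pigeonhole principle,
  applied to colours, to pairs of colours, or to the orbits of \<open>Alt 6\<close> on pairs of subsets.\<close>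

section \<open>Partitions as colourings\<close>

text \<open>Signs account for the difference between \<open>Sym\<close> and \<open>Alt\<close>.
  Against \<open>Sym\<close> a colouring has to be injective, while against \<open>Alt\<close> one
  colour, or one pair of colours, may be used twice, because the only nontrivial permutation
  preserving it is then a transposition. In two borderline cases an injective colouring exists but
  fails all the same: \<open>n\<close> colours for \<open>Sym n \<times> Sym n\<close>, and
  \<open>m\<close> colours for the diagonal group when \<open>n = m * m\<close>. Every colour or
  pair of colours then occurs, so matching equal colours across the parts gives an interchanging
  element that preserves the colouring, and one more colour is needed. In the alternating cases the
  repeated colour itself breaks this symmetry. The obstacle is that the elements of \<open>G\<close>
  outside \<open>G\<^sup>+\<close> are not given; it has to be shown that they interchange the
  parts. In \<open>complete_bipartite n\<close> adjacency decides this. The crown graph for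
  \<open>n = 2\<close> consists of two disjoint edges and has automorphisms that mix the parts, so
  there the argument is group-theoretic.\<close>

lemma distinguishing_number_eqI:
  fixes \<Omega> :: "'a set"
  assumes fin: "finite \<Omega>"
    and perm: "\<And>g. g \<in> G \<Longrightarrow> g permutes \<Omega>"
    and one: "id \<in> G"
    and upper: "card (f ` \<Omega>) \<le> Suc m" "\<And>g. g \<in> G \<Longrightarrow> (\<forall>x\<in>\<Omega>. f (g x) = f x) \<Longrightarrow> g = id"
    and lower: "\<And>c :: 'a \<Rightarrow> nat. (\<forall>x\<in>\<Omega>. c x < m) \<Longrightarrow> \<exists>g\<in>G. g \<noteq> id \<and> (\<forall>x\<in>\<Omega>. c (g x) = c x)"
  shows "distinguishing_number \<Omega> G = Suc m"
proof -
  define Q where "Q k \<longleftrightarrow> (\<exists>P. finite P \<and> card P = k \<and> distinguishing_partition \<Omega> G P)" for k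
  define fib where "fib c = {x \<in> \<Omega>. f x = c}" for c
  define P where "P = fib ` (f ` \<Omega>)"
  have "partition_on \<Omega> P"
    by (rule partition_onI) (auto simp: P_def fib_def disjnt_def)
  moreover have "g = id" if g: "g \<in> G" "\<forall>B\<in>P. g ` B = B" for g
  proof (rule upper(2)[OF g(1)], intro ballI)
    fix x assume "x \<in> \<Omega>"
    then have "fib (f x) \<in> P" "x \<in> fib (f x)" by (auto simp: P_def fib_def)
    then have "g x \<in> fib (f x)" using g(2) by blast
    then show "f (g x) = f x" by (simp add: fib_def)
  qed
  ultimately have dist: "distinguishing_partition \<Omega> G P"
    using one by (auto simp: distinguishing_partition_def)
  have "card P \<le> Suc m" "finite P"
    using upper(1) fin card_image_le[of "f ` \<Omega>" fib] by (auto simp: P_def)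
  then have QP: "Q (card P)" using dist by (auto simp: Q_def)
  \<comment> \<open>An enumeration \<open>e\<close> of the blocks turns a partition into
    \<open>k \<le> m\<close> blocks into a colouring by numbers below \<open>m\<close>. Not all of
    these have to occur, so every smaller \<open>k\<close> is refuted at once, and the number of
    fibres of \<open>f\<close> is forced to be \<open>Suc m\<close>.\<close>
  have lb: "Suc m \<le> k" if "Q k" for k
  proof (rule ccontr)
    assume "\<not> Suc m \<le> k"
    from \<open>Q k\<close> obtain R where R: "finite R" "card R = k" "distinguishing_partition \<Omega> G R"
      by (auto simp: Q_def)
    have part: "partition_on \<Omega> R" and triv: "{g \<in> G. \<forall>B\<in>R. g ` B = B} = {id}"
      using R(3) by (auto simp: distinguishing_partition_def)
    obtain e where e: "inj_on e R" "e ` R \<subseteq> {..<k}"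
      using R(1,2) by (metis ex_bij_betw_finite_nat bij_betw_def atLeast0LessThan order_refl)
    define blk where "blk x = (THE B. B \<in> R \<and> x \<in> B)" for x
    have blk: "blk x = B" if "B \<in> R" "x \<in> B" for B x
      unfolding blk_def using part that
      by (intro the_equality) (auto simp: partition_on_def disjoint_def)
    have cov: "\<exists>B\<in>R. x \<in> B" if "x \<in> \<Omega>" for x
      using part that by (auto simp: partition_on_def)
    have "\<forall>x\<in>\<Omega>. e (blk x) < m"
    proof
      fix x assume "x \<in> \<Omega>"
      then obtain B where "B \<in> R" "x \<in> B" using cov by blast
      with blk e \<open>\<not> Suc m \<le> k\<close> show "e (blk x) < m" by fastforce
    qed
    from lower[OF this] obtain g where g: "g \<in> G" "g \<noteq> id" "\<forall>x\<in>\<Omega>. e (blk (g x)) = e (blk x)"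
      by blast
    have "g ` B = B" if "B \<in> R" for B
    proof -
      have B: "B \<subseteq> \<Omega>" using part that by (auto simp: partition_on_def)
      have "g x \<in> B" if x: "x \<in> B" for x
      proof -
        have "x \<in> \<Omega>" using x B by blast
        then have "g x \<in> \<Omega>" using perm[OF g(1)] by (simp add: permutes_in_image)
        then obtain B' where B': "B' \<in> R" "g x \<in> B'" using cov by blast
        have "e B' = e B" using g(3) \<open>x \<in> \<Omega>\<close> blk[OF B'] blk[OF \<open>B \<in> R\<close> x] by auto
        then show ?thesis using e(1) B' \<open>B \<in> R\<close> by (auto dest: inj_onD)
      qed
      then show ?thesis
        using perm[OF g(1)] finite_subset[OF B fin]
        by (intro endo_inj_surj) (auto intro: permutes_inj_on)
    qed
    with g triv show False by blast
  qed
  have "card P = Suc m" using lb[OF QP] \<open>card P \<le> Suc m\<close> by simp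
  then show ?thesis
    unfolding distinguishing_number_def
    using QP lb by (intro Least_equality) (auto simp: Q_def)
qed

section \<open>Permutations preserving a function\<close>

lemma fixed_outside_pair:
  assumes p: "p permutes S" and fixed: "\<And>i. i \<in> S - {a, b} \<Longrightarrow> p i = i"
  shows "p = id \<or> p = Transposition.transpose a b"
proof -
  have "p permutes {a, b}"
    by (rule permutes_superset[OF p]) (use fixed in auto)
  then show ?thesis by (simp add: permutes_doubleton_iff)
qed

lemma preserving_injective_eq_id:
  assumes p: "p permutes S" and f: "inj_on f S" "\<And>i. i \<in> S \<Longrightarrow> f (p i) = f i"
  shows "p = id"
proof
  fix i show "p i = id i"
  proof (cases "i \<in> S")
    case True
    then have "p i \<in> S" using p by (simp add: permutes_in_image)
    with True f show ?thesis by (auto dest: inj_onD)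
  qed (use p in \<open>simp add: permutes_not_in\<close>)
qed

text \<open>\<open>{a, b}\<close> is the only colour class with more than one point, so all other
  points stay fixed. This computes the stabilisers of the colourings with one repeated
  colour.\<close>

lemma preserving_almost_injective:
  assumes p: "p permutes S" and f: "inj_on f (S - {a})" "f a = f b" "\<And>i. i \<in> S \<Longrightarrow> f (p i) = f i"
    and "b \<in> S" "a \<noteq> b"
  shows "p = id \<or> p = Transposition.transpose a b"
proof (rule fixed_outside_pair[OF p])
  fix i assume i: "i \<in> S - {a, b}"
  have "p i \<noteq> a"
  proof
    assume "p i = a"
    then have "f i = f b" using f(2,3) i by force
    then show False using f(1) i \<open>b \<in> S\<close> \<open>a \<noteq> b\<close> by (auto dest: inj_onD)
  qed
  then show "p i = i"
    using f(1) f(3)[of i] i p by (auto simp: permutes_in_image dest!: inj_onD)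
qed

lemma even_almost_injective_eq_id:
  assumes "p permutes S" "inj_on f (S - {a})" "f a = f b" "\<And>i. i \<in> S \<Longrightarrow> f (p i) = f i"
    and "b \<in> S" "a \<noteq> b" "evenperm p"
  shows "p = id"
  using preserving_almost_injective[OF assms(1-6)] assms(6,7) by (auto simp: evenperm_swap)

lemma ex_collision:
  assumes "card (f ` S) < card S"
  obtains a b where "a \<in> S" "b \<in> S" "a \<noteq> b" "f a = f b"
  using assms pigeonhole[of f S] by (auto simp: inj_on_def)

text \<open>Two spare points force two collisions: when \<open>a\<close> from the first one is
  removed, all colours still occur, so a second collision \<open>c\<close>, \<open>d\<close> avoids
  \<open>a\<close>. The two transpositions are different, and their product is a 3-cycle or a double
  transposition.\<close>

lemma ex_even_preserving:
  fixes f :: "nat \<Rightarrow> 'c"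
  assumes "card (f ` {1..n}) + 2 \<le> n"
  obtains p where "p \<in> Alt n" "p \<noteq> id" "\<And>i. f (p i) = f i"
proof -
  have "card (f ` {1..n}) < card {1..n}" using assms by simp
  then obtain a b where ab: "a \<in> {1..n}" "b \<in> {1..n}" "a \<noteq> b" "f a = f b"
    by (rule ex_collision)
  have "f ` {1..n} = f ` ({1..n} - {a})"
  proof
    have "f a \<in> f ` ({1..n} - {a})" using ab by (metis DiffI imageI singletonD)
    then show "f ` {1..n} \<subseteq> f ` ({1..n} - {a})" by auto
  qed auto
  then have "card (f ` ({1..n} - {a})) < card ({1..n} - {a})"
    using assms ab(1) by simp
  then obtain c d where cd: "c \<in> {1..n} - {a}" "d \<in> {1..n} - {a}" "c \<noteq> d" "f c = f d"
    by (rule ex_collision)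
  let ?p = "Transposition.transpose a b \<circ> Transposition.transpose c d"
  have "?p a = b" using cd by auto
  have "?p \<noteq> id"
  proof
    assume "?p = id"
    from fun_cong[OF this, of a] \<open>?p a = b\<close> ab(3) show False by simp
  qed
  moreover have "?p \<in> Alt n"
    using ab cd permutes_swap_id[of a "{1..n}" b] permutes_swap_id[of c "{1..n}" d]
    by (auto simp: alt_group_carrier evenperm_comp evenperm_swap permutation_swap_id
        intro!: permutes_compose)
  moreover have "f (Transposition.transpose a b i) = f i" "f (Transposition.transpose c d i) = f i" for i
    using ab(4) cd(4) by (simp_all add: Transposition.transpose_def)
  then have "f (?p i) = f i" for i by simp
  ultimately show ?thesis using that by blast
qed

section \<open>Groups acting on two parts of equal size\<close>

definition both_parts :: "nat \<Rightarrow> (nat + nat) set" where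
  "both_parts n = left_part n \<union> right_part n"

definition keeps_sides :: "nat \<Rightarrow> (nat + nat \<Rightarrow> nat + nat) \<Rightarrow> bool" where
  "keeps_sides n g \<longleftrightarrow> (\<forall>x\<in>both_parts n. isl (g x) = isl x)"

text \<open>Every vertex changes side, which is more than the failure of \<open>keeps_sides\<close>.
  The condition is restricted to vertices because the permutations fix all points outside.\<close>

definition swaps_sides :: "nat \<Rightarrow> (nat + nat \<Rightarrow> nat + nat) \<Rightarrow> bool" where
  "swaps_sides n g \<longleftrightarrow> (\<forall>x\<in>both_parts n. isl (g x) \<noteq> isl x)"

lemma in_both_parts [simp]:
  "Inl i \<in> both_parts n \<longleftrightarrow> i \<in> {1..n}" "Inr i \<in> both_parts n \<longleftrightarrow> i \<in> {1..n}"
  by (auto simp: both_parts_def left_part_def right_part_def)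

lemma finite_both_parts: "finite (both_parts n)"
  by (simp add: both_parts_def left_part_def right_part_def)

lemma both_parts_cases:
  assumes "x \<in> both_parts n"
  obtains i where "i \<in> {1..n}" "x = Inl i" | i where "i \<in> {1..n}" "x = Inr i"
  using assms by (auto simp: both_parts_def left_part_def right_part_def)

lemma ball_both_parts:
  "(\<forall>x\<in>both_parts n. P x) \<longleftrightarrow> (\<forall>i\<in>{1..n}. P (Inl i) \<and> P (Inr i))"
  by (auto simp: both_parts_def left_part_def right_part_def)

lemma permutes_both_partsD:
  assumes "g permutes both_parts n" "x \<in> both_parts n"
  shows "g x \<in> both_parts n"
  using assms by (simp add: permutes_in_image)

lemma bip_perm_simps [simp]:
  "bip_perm (p, q) (Inl i) = Inl (p i)" "bip_perm (p, q) (Inr i) = Inr (q i)"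
  by (simp_all add: bip_perm_def)

lemma bip_perm_eq_id_iff [simp]: "bip_perm (p, q) = id \<longleftrightarrow> p = id \<and> q = id"
proof
  assume eq: "bip_perm (p, q) = id"
  have "p i = i" "q i = i" for i
    using fun_cong[OF eq, of "Inl i"] fun_cong[OF eq, of "Inr i"] by simp_all
  then show "p = id \<and> q = id" by auto
qed (simp add: bip_perm_def map_sum.id)

lemma keeps_sides_iff:
  assumes g: "g permutes both_parts n"
  shows "keeps_sides n g \<longleftrightarrow> g ` left_part n = left_part n \<and> g ` right_part n = right_part n"
    (is "?k \<longleftrightarrow> ?r")
proof
  assume ?k
  have "g ` left_part n \<subseteq> left_part n"
  proof (clarsimp simp: left_part_def)
    fix i assume "Suc 0 \<le> i" "i \<le> n"
    then have i: "Inl i \<in> both_parts n" by simp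
    with \<open>?k\<close> have "isl (g (Inl i))" by (auto simp: keeps_sides_def)
    with permutes_both_partsD[OF g i] show "g (Inl i) \<in> Inl ` {Suc 0..n}"
      by (auto simp: isl_def)
  qed
  moreover have "g ` right_part n \<subseteq> right_part n"
  proof (clarsimp simp: right_part_def)
    fix i assume "Suc 0 \<le> i" "i \<le> n"
    then have i: "Inr i \<in> both_parts n" by simp
    with \<open>?k\<close> have "\<not> isl (g (Inr i))" by (auto simp: keeps_sides_def)
    with permutes_both_partsD[OF g i] show "g (Inr i) \<in> Inr ` {Suc 0..n}"
      by (cases "g (Inr i)") auto
  qed
  ultimately show ?r
    using permutes_inj_on[OF g] endo_inj_surj[of "left_part n" g] endo_inj_surj[of "right_part n" g]
    by (simp add: left_part_def right_part_def)
next
  assume ?r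
  then have "g (Inl i) \<in> left_part n" "g (Inr i) \<in> right_part n" if "i \<in> {1..n}" for i
    using that by (auto simp: left_part_def right_part_def)
  then show ?k
    by (fastforce simp: keeps_sides_def ball_both_parts left_part_def right_part_def)
qed

text \<open>The image of the left part lies in one part and fills it, both having \<open>n\<close>
  elements; the right part has to go to the other one.\<close>

lemma keeps_or_swaps_sides:
  assumes g: "g permutes both_parts n"
    and same: "\<And>i j. i \<in> {1..n} \<Longrightarrow> j \<in> {1..n} \<Longrightarrow> isl (g (Inl i)) = isl (g (Inl j))"
  shows "keeps_sides n g \<or> swaps_sides n g"
proof -
  have img: "g ` left_part n \<union> g ` right_part n = left_part n \<union> right_part n"
    using permutes_image[OF g] by (simp add: both_parts_def image_Un)
  have fin: "finite (left_part n)" "finite (right_part n)"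
    and disj: "left_part n \<inter> right_part n = {}"
    and cards: "card (g ` left_part n) = n" "card (left_part n) = n" "card (right_part n) = n"
    using permutes_inj_on[OF g]
    by (auto simp: left_part_def right_part_def card_image)
  have gdisj: "g ` left_part n \<inter> g ` right_part n = {}"
    using permutes_inj[OF g] disj by (metis image_Int image_empty)
  consider "g ` left_part n \<subseteq> left_part n" | "g ` left_part n \<subseteq> right_part n"
  proof -
    have side: "isl (g (Inl i)) \<Longrightarrow> g (Inl i) \<in> left_part n"
      "\<not> isl (g (Inl i)) \<Longrightarrow> g (Inl i) \<in> right_part n" if "i \<in> {1..n}" for i
      using permutes_both_partsD[OF g, of "Inl i"] that
      by (cases "g (Inl i)"; simp add: left_part_def right_part_def)+
    show ?thesis
    proof (cases "\<exists>i\<in>{1..n}. isl (g (Inl i))")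
      case True
      then have "isl (g (Inl i))" if "i \<in> {1..n}" for i using same that by blast
      then show ?thesis using that(1) side(1) unfolding left_part_def[of n] by blast
    next
      case False
      then show ?thesis using that(2) side(2) unfolding left_part_def[of n] by blast
    qed
  qed
  then show ?thesis
  proof cases
    case 1
    then have l: "g ` left_part n = left_part n"
      using fin cards by (intro card_subset_eq) auto
    have "g ` right_part n = right_part n"
    proof -
      have "g ` right_part n = (g ` left_part n \<union> g ` right_part n) - g ` left_part n"
        using gdisj by blast
      also have "\<dots> = right_part n" unfolding img unfolding l using disj by blast
      finally show ?thesis .
    qed
    with l have "keeps_sides n g"
      unfolding keeps_sides_iff[OF g] by simp
    then show ?thesis ..
  next
    case 2
    then have l: "g ` left_part n = right_part n"
      using fin cards by (intro card_subset_eq) auto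
    have r: "g ` right_part n = left_part n"
    proof -
      have "g ` right_part n = (g ` left_part n \<union> g ` right_part n) - g ` left_part n"
        using gdisj by blast
      also have "\<dots> = left_part n" unfolding img unfolding l using disj by blast
      finally show ?thesis .
    qed
    have "g (Inl i) \<in> g ` left_part n" "g (Inr i) \<in> g ` right_part n" if "i \<in> {1..n}" for i
      using that by (simp_all add: left_part_def right_part_def)
    then have "g (Inl i) \<in> right_part n" "g (Inr i) \<in> left_part n" if "i \<in> {1..n}" for i
      using that unfolding l r by blast+
    then have "swaps_sides n g"
      by (fastforce simp: swaps_sides_def ball_both_parts left_part_def right_part_def)
    then show ?thesis ..
  qed
qed

lemma keeps_sides_imp_bip_perm:
  assumes g: "g permutes both_parts n" and k: "keeps_sides n g"
  obtains p q where "p \<in> Sym n" "q \<in> Sym n" "g = bip_perm (p, q)"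
proof -
  define p where "p i = (if i \<in> {1..n} then projl (g (Inl i)) else i)" for i
  define q where "q i = (if i \<in> {1..n} then projr (g (Inr i)) else i)" for i
  have gl: "g (Inl i) = Inl (p i)" and gr: "g (Inr i) = Inr (q i)" for i
  proof -
    have "isl (g (Inl i))" "\<not> isl (g (Inr i))" if "i \<in> {1..n}"
      using k that by (auto simp: keeps_sides_def ball_both_parts)
    then show "g (Inl i) = Inl (p i)" "g (Inr i) = Inr (q i)"
      using permutes_not_in[OF g, of "Inl i"] permutes_not_in[OF g, of "Inr i"]
      by (auto simp: p_def q_def)
  qed
  have "p permutes {1..n}"
  proof (rule inj_imp_permutes)
    show "inj_on p {1..n}"
      using permutes_inj[OF g] gl by (metis injD inj_onI sum.inject(1))
    show "p i \<in> {1..n}" if "i \<in> {1..n}" for i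
      using permutes_both_partsD[OF g, of "Inl i"] that by (simp add: gl)
  qed (auto simp: p_def)
  moreover have "q permutes {1..n}"
  proof (rule inj_imp_permutes)
    show "inj_on q {1..n}"
      using permutes_inj[OF g] gr by (metis injD inj_onI sum.inject(2))
    show "q i \<in> {1..n}" if "i \<in> {1..n}" for i
      using permutes_both_partsD[OF g, of "Inr i"] that by (simp add: gr)
  qed (auto simp: q_def)
  moreover have "g = bip_perm (p, q)"
  proof
    fix x show "g x = bip_perm (p, q) x"
      by (cases x) (simp_all add: gl gr)
  qed
  ultimately show ?thesis using that by (simp add: sym_group_carrier)
qed

text \<open>An interchanging element that preserves \<open>c\<close> injects each left colour class
  into the right class of the same colour. A colour that is more frequent on the left refutes it,
  and each colouring chosen for \<open>complete_bipartite n\<close> has one.\<close>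

lemma swap_preserving_card_le:
  assumes x: "x permutes both_parts n" "swaps_sides n x"
    and c: "\<forall>y\<in>both_parts n. c (x y) = c y"
  shows "card {i \<in> {1..n}. c (Inl i) = k} \<le> card {i \<in> {1..n}. c (Inr i) = k}"
proof -
  have l: "\<exists>j\<in>{1..n}. x (Inl i) = Inr j" if "i \<in> {1..n}" for i
  proof -
    have "\<not> isl (x (Inl i))" "x (Inl i) \<in> both_parts n"
      using x(2) that permutes_both_partsD[OF x(1)] by (auto simp: swaps_sides_def ball_both_parts)
    then show ?thesis by (cases "x (Inl i)") simp_all
  qed
  have inj: "x a = x b \<longleftrightarrow> a = b" for a b
    using permutes_inj[OF x(1)] by (auto dest: injD)
  show "card {i \<in> {1..n}. c (Inl i) = k} \<le> card {i \<in> {1..n}. c (Inr i) = k}"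
  proof (rule card_inj_on_le)
    show "inj_on (\<lambda>i. projr (x (Inl i))) {i \<in> {1..n}. c (Inl i) = k}"
    proof (rule inj_onI)
      fix i j assume "i \<in> {i \<in> {1..n}. c (Inl i) = k}" "j \<in> {i \<in> {1..n}. c (Inl i) = k}"
        and eq: "projr (x (Inl i)) = projr (x (Inl j))"
      then obtain i' j' where "x (Inl i) = Inr i'" "x (Inl j) = Inr j'" using l by blast
      with eq have "x (Inl i) = x (Inl j)" by simp
      then show "i = j" by (simp add: inj)
    qed
    show "(\<lambda>i. projr (x (Inl i))) ` {i \<in> {1..n}. c (Inl i) = k} \<subseteq> {i \<in> {1..n}. c (Inr i) = k}"
    proof clarify
      fix i assume i: "i \<in> {1..n}"
      with l obtain j where "j \<in> {1..n}" "x (Inl i) = Inr j" by blast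
      moreover have "c (x (Inl i)) = c (Inl i)" using c i by (simp add: ball_both_parts)
      ultimately show "projr (x (Inl i)) \<in> {1..n} \<and> c (Inr (projr (x (Inl i)))) = c (Inl i)"
        by simp
    qed
  qed simp
qed

section \<open>Groups whose part-preserving subgroup has index two\<close>

locale index_two =
  fixes n :: nat and \<Gamma> :: "(nat + nat) sgraph" and G :: "(nat + nat \<Rightarrow> nat + nat) set"
  assumes verts: "verts \<Gamma> = both_parts n"
    and subgroup: "subgroup G (Aut \<Gamma>)"
    and index: "card (rcosets\<^bsub>Aut \<Gamma>\<lparr>carrier := G\<rparr>\<^esub> part_preserving n G) = 2"
begin

lemma one_mem: "id \<in> G"
  using subgroup.one_closed[OF subgroup] by (simp add: Aut_def)

lemma comp_mem: "g \<in> G \<Longrightarrow> h \<in> G \<Longrightarrow> g \<circ> h \<in> G"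
  using subgroup.m_closed[OF subgroup] by (simp add: Aut_def)

lemma mem_permutes: "g \<in> G \<Longrightarrow> g permutes both_parts n"
  using subgroup.subset[OF subgroup] verts by (auto simp: Aut_def)

lemma mem_edges:
  assumes "g \<in> G" "x \<in> both_parts n" "y \<in> both_parts n"
  shows "{g x, g y} \<in> edges \<Gamma> \<longleftrightarrow> {x, y} \<in> edges \<Gamma>"
  using subgroup.subset[OF subgroup] verts assms by (auto simp: Aut_def)

lemma inv_mem:
  assumes "g \<in> G"
  shows "Hilbert_Choice.inv g \<in> G"
proof -
  let ?h = "Hilbert_Choice.inv g"
  note p = mem_permutes[OF assms]
  have h: "?h permutes both_parts n" by (rule permutes_inv[OF p])
  have "?h \<in> carrier (Aut \<Gamma>)"
    using h mem_edges[OF assms, of "?h x" "?h y" for x y] permutes_both_partsD[OF h]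
    by (auto simp: Aut_def verts permutes_inverses(1)[OF p])
  \<comment> \<open>\<open>m_inv\<close> is a definite description, so the inverse function has to
    lie in the carrier and to be the only two-sided inverse there.\<close>
  moreover from this have "inv\<^bsub>Aut \<Gamma>\<^esub> g = ?h"
  proof -
    assume h: "?h \<in> carrier (Aut \<Gamma>)"
    have "inv\<^bsub>Aut \<Gamma>\<^esub> g = (THE y. y \<in> carrier (Aut \<Gamma>) \<and> g \<circ> y = id \<and> y \<circ> g = id)"
      by (simp add: m_inv_def Aut_def)
    also have "\<dots> = ?h"
    proof (rule the_equality)
      show "?h \<in> carrier (Aut \<Gamma>) \<and> g \<circ> ?h = id \<and> ?h \<circ> g = id"
        using h permutes_inv_o[OF p] by simp
    next
      fix y assume "y \<in> carrier (Aut \<Gamma>) \<and> g \<circ> y = id \<and> y \<circ> g = id"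
      then show "y = ?h" by (intro inv_unique_comp[symmetric]) auto
    qed
    finally show ?thesis .
  qed
  ultimately show ?thesis using subgroup.m_inv_closed[OF subgroup assms] by simp
qed

lemma plus_iff: "g \<in> part_preserving n G \<longleftrightarrow> g \<in> G \<and> keeps_sides n g"
  unfolding part_preserving_def using keeps_sides_iff mem_permutes by blast

lemma plus_comp:
  assumes "g \<in> part_preserving n G" "h \<in> part_preserving n G"
  shows "g \<circ> h \<in> part_preserving n G"
  using assms comp_mem permutes_both_partsD[OF mem_permutes]
  by (auto simp: plus_iff keeps_sides_def)

lemma plus_inv:
  assumes "g \<in> part_preserving n G"
  shows "Hilbert_Choice.inv g \<in> part_preserving n G"
proof -
  have g: "g \<in> G" "keeps_sides n g" using assms by (auto simp: plus_iff)
  have "isl (Hilbert_Choice.inv g x) = isl x" if "x \<in> both_parts n" for x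
    using g(2) that permutes_both_partsD[OF permutes_inv[OF mem_permutes[OF g(1)]]]
      permutes_inverses(1)[OF mem_permutes[OF g(1)]]
    unfolding keeps_sides_def by metis
  then show ?thesis using inv_mem[OF g(1)] by (simp add: plus_iff keeps_sides_def)
qed

lemma cosets:
  "rcosets\<^bsub>Aut \<Gamma>\<lparr>carrier := G\<rparr>\<^esub> part_preserving n G = (\<lambda>a. (\<lambda>h. h \<circ> a) ` part_preserving n G) ` G"
  by (auto simp: RCOSETS_def r_coset_def Aut_def)

lemma coset_eq_plus_iff:
  assumes "a \<in> G"
  shows "(\<lambda>h. h \<circ> a) ` part_preserving n G = part_preserving n G \<longleftrightarrow> a \<in> part_preserving n G"
proof
  have "id \<circ> a \<in> (\<lambda>h. h \<circ> a) ` part_preserving n G"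
    using one_mem by (intro imageI) (simp add: plus_iff keeps_sides_def id_def)
  moreover assume "(\<lambda>h. h \<circ> a) ` part_preserving n G = part_preserving n G"
  ultimately show "a \<in> part_preserving n G" by simp
next
  assume a: "a \<in> part_preserving n G"
  have "h \<in> (\<lambda>h. h \<circ> a) ` part_preserving n G" if "h \<in> part_preserving n G" for h
  proof (rule image_eqI)
    show "h = (h \<circ> Hilbert_Choice.inv a) \<circ> a"
      by (simp add: comp_assoc permutes_inv_o[OF mem_permutes[OF assms]])
    show "h \<circ> Hilbert_Choice.inv a \<in> part_preserving n G"
      by (rule plus_comp[OF that plus_inv[OF a]])
  qed
  with a plus_comp show "(\<lambda>h. h \<circ> a) ` part_preserving n G = part_preserving n G" by blast
qed

lemma ex_not_plus: obtains x where "x \<in> G" "x \<notin> part_preserving n G"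
proof -
  have "False" if "G \<subseteq> part_preserving n G"
  proof -
    have "rcosets\<^bsub>Aut \<Gamma>\<lparr>carrier := G\<rparr>\<^esub> part_preserving n G \<subseteq> {part_preserving n G}"
      using that coset_eq_plus_iff by (auto simp: cosets)
    then have "card (rcosets\<^bsub>Aut \<Gamma>\<lparr>carrier := G\<rparr>\<^esub> part_preserving n G) \<le> card {part_preserving n G}"
      by (rule card_mono[rotated]) simp
    then show False using index by simp
  qed
  then show ?thesis using that by blast
qed

text \<open>There is only one coset besides \<open>part_preserving n G\<close>, and \<open>x\<close>
  and \<open>y\<close> share it: one element outside yields all the others.\<close>

lemma not_plus_factor:
  assumes "x \<in> G" "x \<notin> part_preserving n G" "y \<in> G" "y \<notin> part_preserving n G"
  obtains h where "h \<in> part_preserving n G" "y = h \<circ> x"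
proof -
  let ?C = "\<lambda>a. (\<lambda>h. h \<circ> a) ` part_preserving n G"
  let ?R = "rcosets\<^bsub>Aut \<Gamma>\<lparr>carrier := G\<rparr>\<^esub> part_preserving n G"
  have id: "id \<in> part_preserving n G" using one_mem by (simp add: plus_iff keeps_sides_def)
  have "?C id \<in> ?R" using one_mem unfolding cosets by (rule imageI)
  then have "part_preserving n G \<in> ?R" using coset_eq_plus_iff[OF one_mem] id by simp
  moreover have "?C x \<in> ?R" "?C y \<in> ?R" using assms unfolding cosets by blast+
  moreover have "?C x \<noteq> part_preserving n G" "?C y \<noteq> part_preserving n G"
    using assms coset_eq_plus_iff by auto
  moreover have "u = v" if "card R = 2" "p \<in> R" "u \<in> R" "v \<in> R" "u \<noteq> p" "v \<noteq> p"
    for R and p u v :: "(nat + nat \<Rightarrow> nat + nat) set"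
    using that by (auto simp: card_2_iff)
  ultimately have "?C x = ?C y" using index by metis
  moreover have "id \<circ> y \<in> ?C y" using id by blast
  ultimately show ?thesis using that by auto
qed

text \<open>A subgroup of index two is normal, so it suffices that the part-preserving elements act
  transitively on the left part.\<close>

lemma not_plus_swaps_if_transitive:
  assumes trans: "\<And>i j. i \<in> {1..n} \<Longrightarrow> j \<in> {1..n} \<Longrightarrow> \<exists>h\<in>part_preserving n G. h (Inl i) = Inl j"
    and x: "x \<in> G" "x \<notin> part_preserving n G"
  shows "swaps_sides n x"
proof -
  have "keeps_sides n x \<or> swaps_sides n x"
  proof (rule keeps_or_swaps_sides[OF mem_permutes[OF x(1)]])
    fix i j assume ij: "i \<in> {1..n}" "j \<in> {1..n}"
    then obtain h where h: "h \<in> part_preserving n G" "h (Inl i) = Inl j" using trans by blast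
    have "x \<circ> h \<notin> part_preserving n G"
    proof
      assume "x \<circ> h \<in> part_preserving n G"
      then have "(x \<circ> h) \<circ> Hilbert_Choice.inv h \<in> part_preserving n G"
        using plus_comp plus_inv h(1) by blast
      moreover have "(x \<circ> h) \<circ> Hilbert_Choice.inv h = x"
        using h(1) permutes_inv_o(1)[OF mem_permutes] by (simp add: comp_assoc plus_iff)
      ultimately show False using x by simp
    qed
    \<comment> \<open>Both \<open>x \<circ> h\<close> and \<open>x\<close> lie in the nontrivial
      coset. This is how normality enters: \<open>h\<close> moves past \<open>x\<close> and becomes
      a \<open>k\<close> that keeps the sides.\<close>
    then obtain k where k: "k \<in> part_preserving n G" "x \<circ> h = k \<circ> x"
      using not_plus_factor[OF x, of "x \<circ> h"] comp_mem[OF x(1)] h(1) plus_iff by blast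
    have "x (Inl j) = k (x (Inl i))" using fun_cong[OF k(2), of "Inl i"] h(2) by simp
    then show "isl (x (Inl i)) = isl (x (Inl j))"
      using k(1) permutes_both_partsD[OF mem_permutes[OF x(1)], of "Inl i"] ij
      by (simp add: plus_iff keeps_sides_def)
  qed
  then show ?thesis using x by (simp add: plus_iff)
qed

end

lemma bip_perm_eq_iff [simp]: "bip_perm x = bip_perm y \<longleftrightarrow> x = y"
proof
  assume eq: "bip_perm x = bip_perm y"
  obtain p q p' q' where xy: "x = (p, q)" "y = (p', q')" by (metis prod.collapse)
  have "p i = p' i" "q i = q' i" for i
    using fun_cong[OF eq, of "Inl i"] fun_cong[OF eq, of "Inr i"] by (simp_all add: xy)
  then show "x = y" by (auto simp: xy)
qed simp

lemma bip_perm_image_iff [simp]: "bip_perm x \<in> bip_perm ` S \<longleftrightarrow> x \<in> S"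
  by auto

lemma id_in_Sym [simp]: "id \<in> Sym n" and id_in_Alt [simp]: "id \<in> Alt n"
  by (simp_all add: sym_group_carrier alt_group_carrier)

lemma Alt_imp_Sym: "h \<in> Alt n \<Longrightarrow> h \<in> Sym n"
  by (simp add: sym_group_carrier alt_group_carrier)

lemma transpose_in_Sym: "i \<in> {1..n} \<Longrightarrow> j \<in> {1..n} \<Longrightarrow> Transposition.transpose i j \<in> Sym n"
  by (simp add: sym_group_carrier permutes_swap_id)

lemma transpose_preserves: "f i = f j \<Longrightarrow> f (Transposition.transpose i j k) = f k"
  by (simp add: Transposition.transpose_def)

context index_two
begin

text \<open>The common frame for all seven groups. It treats the two cosets separately:
  \<open>keep_triv\<close> speaks of pairs of permutations, \<open>no_swap\<close> of interchanging
  elements. The offset \<open>l\<close> lets the colours start at 0 or 1. In \<open>lower\<close> a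
  colouring is split into its restrictions \<open>a\<close> and \<open>b\<close> to the two parts,
  where the counting takes place.\<close>

lemma distinguishing_number_eq_Suc:
  fixes f :: "nat + nat \<Rightarrow> nat"
  assumes swap: "\<And>x. x \<in> G \<Longrightarrow> x \<notin> part_preserving n G \<Longrightarrow> swaps_sides n x"
    and few: "\<And>x. x \<in> both_parts n \<Longrightarrow> f x \<in> {l..<l + Suc m}"
    and keep_triv: "\<And>p q. bip_perm (p, q) \<in> part_preserving n G \<Longrightarrow> p permutes {1..n} \<Longrightarrow> q permutes {1..n}
      \<Longrightarrow> (\<And>i. i \<in> {1..n} \<Longrightarrow> f (Inl (p i)) = f (Inl i))
      \<Longrightarrow> (\<And>i. i \<in> {1..n} \<Longrightarrow> f (Inr (q i)) = f (Inr i)) \<Longrightarrow> p = id \<and> q = id"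
    and no_swap: "\<And>x. x \<in> G \<Longrightarrow> swaps_sides n x \<Longrightarrow> \<forall>y\<in>both_parts n. f (x y) = f y \<Longrightarrow> False"
    and lower: "\<And>a b :: nat \<Rightarrow> nat. (\<And>i. i \<in> {1..n} \<Longrightarrow> a i < m) \<Longrightarrow> (\<And>i. i \<in> {1..n} \<Longrightarrow> b i < m)
      \<Longrightarrow> \<exists>g\<in>G. g \<noteq> id \<and> (\<forall>i\<in>{1..n}. case_sum a b (g (Inl i)) = a i \<and> case_sum a b (g (Inr i)) = b i)"
  shows "distinguishing_number (verts \<Gamma>) G = Suc m"
  unfolding verts
proof (rule distinguishing_number_eqI[OF finite_both_parts mem_permutes one_mem])
  show "card (f ` both_parts n) \<le> Suc m"
    using card_mono[of "{l..<l + Suc m}" "f ` both_parts n"] few by (simp add: image_subset_iff)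
next
  fix g assume g: "g \<in> G" "\<forall>x\<in>both_parts n. f (g x) = f x"
  show "g = id"
  proof (cases "g \<in> part_preserving n G")
    case True
    then obtain p q where pq: "p \<in> Sym n" "q \<in> Sym n" "g = bip_perm (p, q)"
      using keeps_sides_imp_bip_perm[OF mem_permutes[OF g(1)]] by (auto simp: plus_iff)
    with keep_triv[of p q] True g(2) show ?thesis
      by (simp add: sym_group_carrier ball_both_parts)
  next
    case False
    with swap no_swap g show ?thesis by blast
  qed
next
  fix c :: "nat + nat \<Rightarrow> nat" assume c: "\<forall>x\<in>both_parts n. c x < m"
  have "\<exists>g\<in>G. g \<noteq> id \<and> (\<forall>i\<in>{1..n}. case_sum (c \<circ> Inl) (c \<circ> Inr) (g (Inl i)) = (c \<circ> Inl) i
      \<and> case_sum (c \<circ> Inl) (c \<circ> Inr) (g (Inr i)) = (c \<circ> Inr) i)"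
    using c by (intro lower) (auto simp: ball_both_parts)
  moreover have "case_sum (c \<circ> Inl) (c \<circ> Inr) = c"
    by (auto simp: fun_eq_iff split: sum.splits)
  ultimately show "\<exists>g\<in>G. g \<noteq> id \<and> (\<forall>x\<in>both_parts n. c (g x) = c x)"
    by (simp add: ball_both_parts)
qed

lemma ex_bip_perm_preserving:
  fixes a b :: "nat \<Rightarrow> nat"
  assumes "bip_perm (p, q) \<in> part_preserving n G" "p \<noteq> id \<or> q \<noteq> id"
    and "\<And>i. i \<in> {1..n} \<Longrightarrow> a (p i) = a i" "\<And>i. i \<in> {1..n} \<Longrightarrow> b (q i) = b i"
  shows "\<exists>g\<in>G. g \<noteq> id \<and> (\<forall>i\<in>{1..n}. case_sum a b (g (Inl i)) = a i \<and> case_sum a b (g (Inr i)) = b i)"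
  using assms by (intro bexI[of _ "bip_perm (p, q)"]) (auto simp: plus_iff)

text \<open>The quotient of two interchanging permutations keeps the sides and so lies in
  \<open>Sym n \<times> Sym n\<close>: one interchanging element of \<open>G\<close> brings in all
  of them.\<close>

lemma mem_if_bip_perm_all:
  assumes all: "bip_perm ` (Sym n \<times> Sym n) \<subseteq> part_preserving n G"
    and x: "x \<in> G" "swaps_sides n x" and y: "y permutes both_parts n" "swaps_sides n y"
  shows "y \<in> G"
proof -
  let ?h = "Hilbert_Choice.inv x \<circ> y"
  note p = mem_permutes[OF x(1)]
  have "?h permutes both_parts n"
    by (rule permutes_compose[OF y(1) permutes_inv[OF p]])
  moreover have "isl (?h v) = isl v" if v: "v \<in> both_parts n" for v
  proof -
    have w: "?h v \<in> both_parts n" using \<open>?h permutes both_parts n\<close> v by (rule permutes_both_partsD)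
    have "x (?h v) = y v" using permutes_inverses(1)[OF p] by simp
    moreover have "isl (x (?h v)) \<noteq> isl (?h v)" using x(2) w unfolding swaps_sides_def by blast
    moreover have "isl (y v) \<noteq> isl v" using y(2) v unfolding swaps_sides_def by blast
    ultimately show ?thesis by metis
  qed
  ultimately obtain p q where "p \<in> Sym n" "q \<in> Sym n" "?h = bip_perm (p, q)"
    using keeps_sides_imp_bip_perm[of ?h n] unfolding keeps_sides_def by metis
  then have "?h \<in> part_preserving n G" using all by auto
  then have "x \<circ> ?h \<in> G" using comp_mem[OF x(1)] plus_iff by blast
  moreover have "x \<circ> ?h = y"
    by (simp add: comp_assoc[symmetric] permutes_inv_o(1)[OF p])
  ultimately show ?thesis by simp
qed

text \<open>On the empty graph \<open>G\<close> would equal its part-preserving subgroup. This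
  excludes \<open>n = 0\<close> for the symmetric groups, where no lower bound on \<open>n\<close>
  is assumed.\<close>

lemma n_pos: "n \<noteq> 0"
proof
  assume "n = 0"
  then have "both_parts n = {}" by (simp add: both_parts_def left_part_def right_part_def)
  then have "x \<in> part_preserving n G" if "x \<in> G" for x
    using that by (simp add: plus_iff keeps_sides_def)
  then show False using ex_not_plus by blast
qed

end

section \<open>Complete bipartite graphs\<close>

locale index_two_complete = index_two n "complete_bipartite n" G for n G
begin

text \<open>Vertices of a complete bipartite graph lie in the same part exactly if they are not
  adjacent, so automorphisms cannot mix the parts.\<close>

lemma not_plus_swaps:
  assumes x: "x \<in> G" "x \<notin> part_preserving n G"
  shows "swaps_sides n x"
proof -
  have "keeps_sides n x \<or> swaps_sides n x"
  proof (rule keeps_or_swaps_sides[OF mem_permutes[OF x(1)]])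
    fix i j assume ij: "i \<in> {1..n}" "j \<in> {1..n}"
    have edge: "{u, v} \<in> edges (complete_bipartite n)" if "isl u \<noteq> isl v" "u \<in> both_parts n" "v \<in> both_parts n" for u v
      using that by (cases u; cases v) (auto simp: complete_bipartite_def insert_commute)
    have "{Inl i, Inl j} \<notin> edges (complete_bipartite n)"
      by (auto simp: complete_bipartite_def doubleton_eq_iff)
    then have "{x (Inl i), x (Inl j)} \<notin> edges (complete_bipartite n)"
      using mem_edges[OF x(1), of "Inl i" "Inl j"] ij by simp
    with edge show "isl (x (Inl i)) = isl (x (Inl j))"
      using permutes_both_partsD[OF mem_permutes[OF x(1)]] ij by (meson in_both_parts(1))
  qed
  then show ?thesis using x by (simp add: plus_iff)
qed

lemma distinguishing_number_Alt_Alt: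
  assumes n: "n \<ge> 3" and plus: "part_preserving n G = bip_perm ` (Alt n \<times> Alt n)"
  shows "distinguishing_number (verts (complete_bipartite n)) G = n - 1"
proof -
  \<comment> \<open>Each part repeats one colour, so its only nontrivial symmetry is an odd
    transposition. The repeated colours are \<open>n - 1\<close> on the left and 1 on the right.
    These differ as \<open>n \<ge> 3\<close>, so \<open>n - 1\<close> occurs twice on the left and
    once on the right.\<close>
  define a where "a i = (if i = n then n - 1 else i)" for i
  define b where "b i = (if i = n then 1 else i)" for i
  have "distinguishing_number (verts (complete_bipartite n)) G = Suc (n - 2)"
  proof (rule distinguishing_number_eq_Suc[where f = "case_sum a b" and l = 1])
    show "case_sum a b x \<in> {1..<1 + Suc (n - 2)}" if "x \<in> both_parts n" for x
      using that n by (auto simp: a_def b_def elim!: both_parts_cases)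
  next
    fix p q assume pq: "bip_perm (p, q) \<in> part_preserving n G" "p permutes {1..n}" "q permutes {1..n}"
      "\<And>i. i \<in> {1..n} \<Longrightarrow> case_sum a b (Inl (p i)) = case_sum a b (Inl i)"
      "\<And>i. i \<in> {1..n} \<Longrightarrow> case_sum a b (Inr (q i)) = case_sum a b (Inr i)"
    have "evenperm p" "evenperm q" using pq(1) by (auto simp: plus alt_group_carrier)
    have "p = id"
    proof (rule even_almost_injective_eq_id[OF pq(2), where f = a and a = n and b = "n - 1"])
      show "inj_on a ({1..n} - {n})" by (auto simp: inj_on_def a_def)
    qed (use pq(4) n \<open>evenperm p\<close> in \<open>auto simp: a_def\<close>)
    moreover have "q = id"
    proof (rule even_almost_injective_eq_id[OF pq(3), where f = b and a = n and b = 1])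
      show "inj_on b ({1..n} - {n})" by (auto simp: inj_on_def b_def)
    qed (use pq(5) n \<open>evenperm q\<close> in \<open>auto simp: b_def\<close>)
    ultimately show "p = id \<and> q = id" ..
  next
    fix x assume x: "x \<in> G" "swaps_sides n x" "\<forall>y\<in>both_parts n. case_sum a b (x y) = case_sum a b y"
    have "card {i \<in> {1..n}. a i = n - 1} \<le> card {i \<in> {1..n}. b i = n - 1}"
      using swap_preserving_card_le[OF mem_permutes[OF x(1)] x(2,3)] by simp
    also have "{i \<in> {1..n}. a i = n - 1} = {n - 1, n}" using n by (auto simp: a_def)
    also have "{i \<in> {1..n}. b i = n - 1} = {n - 1}" using n by (auto simp: b_def)
    finally show False using n by simp
  next
    fix a b :: "nat \<Rightarrow> nat" assume "\<And>i. i \<in> {1..n} \<Longrightarrow> a i < n - 2"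
    then have "card (a ` {1..n}) \<le> card {..<n - 2}" by (intro card_mono) auto
    then have "card (a ` {1..n}) + 2 \<le> n" using n by simp
    then obtain p where "p \<in> Alt n" "p \<noteq> id" "\<And>i. a (p i) = a i" using ex_even_preserving by blast
    then show "\<exists>g\<in>G. g \<noteq> id \<and> (\<forall>i\<in>{1..n}. case_sum a b (g (Inl i)) = a i \<and> case_sum a b (g (Inr i)) = b i)"
      by (intro ex_bip_perm_preserving[of p id]) (auto simp: plus)
  qed (rule not_plus_swaps)
  then show ?thesis using n by simp
qed

lemma distinguishing_number_Sym_Sym:
  assumes plus: "part_preserving n G = bip_perm ` (Sym n \<times> Sym n)"
  shows "distinguishing_number (verts (complete_bipartite n)) G = n + 1"
proof -
  have "distinguishing_number (verts (complete_bipartite n)) G = Suc n"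
  \<comment> \<open>The left part uses the colours 1 to \<open>n\<close>, the right part 2 to
    \<open>n + 1\<close>, so colour 1 is missing on the right.\<close>
  proof (rule distinguishing_number_eq_Suc[where f = "case_sum id Suc" and l = 1])
    show "case_sum id Suc x \<in> {1..<1 + Suc n}" if "x \<in> both_parts n" for x
      using that by (auto elim!: both_parts_cases)
  next
    fix p q assume pq: "p permutes {1..n}" "q permutes {1..n}"
      "\<And>i. i \<in> {1..n} \<Longrightarrow> case_sum id Suc (Inl (p i)) = case_sum id Suc (Inl i)"
      "\<And>i. i \<in> {1..n} \<Longrightarrow> case_sum id Suc (Inr (q i)) = case_sum id Suc (Inr i)"
    then show "p = id \<and> q = id"
      by (auto intro: preserving_injective_eq_id[where f = id])
  next
    fix x assume x: "x \<in> G" "swaps_sides n x" "\<forall>y\<in>both_parts n. case_sum id Suc (x y) = case_sum id Suc y"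
    have "card {i \<in> {1..n}. i = 1} \<le> card {i \<in> {1..n}. i = 0}"
      using swap_preserving_card_le[OF mem_permutes[OF x(1)] x(2,3), of 1] by simp
    also have "{i \<in> {1..n}. i = 1} = {1}" using n_pos by auto
    also have "{i \<in> {1..n}. i = 0} = {}" by auto
    finally show False by simp
  next
    fix a b :: "nat \<Rightarrow> nat"
    assume less: "\<And>i. i \<in> {1..n} \<Longrightarrow> a i < n" "\<And>i. i \<in> {1..n} \<Longrightarrow> b i < n"
    consider i j where "i \<in> {1..n}" "j \<in> {1..n}" "i \<noteq> j" "a i = a j"
      | i j where "i \<in> {1..n}" "j \<in> {1..n}" "i \<noteq> j" "b i = b j"
      | "inj_on a {1..n}" "inj_on b {1..n}"
      unfolding inj_on_def by blast
    then show "\<exists>g\<in>G. g \<noteq> id \<and> (\<forall>i\<in>{1..n}. case_sum a b (g (Inl i)) = a i \<and> case_sum a b (g (Inr i)) = b i)"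
    proof cases
      case 1
      then show ?thesis
        by (intro ex_bip_perm_preserving[of "Transposition.transpose i j" id])
          (auto simp: plus transpose_in_Sym transpose_preserves transpose_eq_id_iff)
    next
      case 2
      then show ?thesis
        by (intro ex_bip_perm_preserving[of id "Transposition.transpose i j"])
          (auto simp: plus transpose_in_Sym transpose_preserves transpose_eq_id_iff)
    next
      case 3
      \<comment> \<open>No transposition is available here, but every colour occurs exactly once in
        each part. The permutation \<open>y\<close> matches equal colours across the parts;
        \<open>s\<close> and \<open>t\<close> are its two halves, inverse to each other.\<close>
      have bij: "bij_betw a {1..n} {..<n}" "bij_betw b {1..n} {..<n}"
        using 3 less card_subset_eq[of "{..<n}" "a ` {1..n}"] card_subset_eq[of "{..<n}" "b ` {1..n}"]
        by (auto simp: bij_betw_def card_image image_subset_iff)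
      define s where "s = inv_into {1..n} b \<circ> a"
      define t where "t = inv_into {1..n} a \<circ> b"
      have st: "s i \<in> {1..n}" "b (s i) = a i" "t i \<in> {1..n}" "a (t i) = b i" if "i \<in> {1..n}" for i
        using that bij bij_betwE[OF bij(1)] bij_betwE[OF bij(2)]
          bij_betwE[OF bij_betw_inv_into[OF bij(1)]] bij_betwE[OF bij_betw_inv_into[OF bij(2)]]
        by (auto simp: s_def t_def bij_betw_inv_into_right)
      have inv: "t (s i) = i" "s (t i) = i" if "i \<in> {1..n}" for i
        using that st 3 by (metis inj_onD)+
      define y where "y v = (if v \<in> both_parts n then case_sum (Inr \<circ> s) (Inl \<circ> t) v else v)" for v
      have y: "y (Inl i) = Inr (s i)" "y (Inr i) = Inl (t i)" if "i \<in> {1..n}" for i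
        using that by (auto simp: y_def)
      have yy: "y v \<in> both_parts n" "y (y v) = v" if "v \<in> both_parts n" for v
        using that st inv y by (auto elim!: both_parts_cases simp del: atLeastAtMost_iff)
      have "y permutes both_parts n"
      proof (rule inj_imp_permutes)
        show "inj_on y (both_parts n)" by (rule inj_onI) (metis yy(2))
      qed (use yy(1) finite_both_parts in \<open>auto simp: y_def\<close>)
      moreover have "swaps_sides n y"
        using y by (auto simp: swaps_sides_def ball_both_parts simp del: atLeastAtMost_iff)
      moreover obtain x where "x \<in> G" "swaps_sides n x" using ex_not_plus not_plus_swaps by blast
      ultimately have "y \<in> G" using mem_if_bip_perm_all plus by blast
      moreover have "y (Inl 1) = Inr (s 1)" by (rule y) (use n_pos in auto)
      then have "y \<noteq> id" by auto
      ultimately show ?thesis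
        using y st by (intro bexI[of _ y]) (auto simp del: atLeastAtMost_iff)
    qed
  qed (rule not_plus_swaps)
  then show ?thesis by simp
qed

text \<open>All generators have components of equal sign, and products and inverses inherit this. It
  lets evenness pass from one part to the other.\<close>

lemma gen_Alt_Alt_transposition_even:
  assumes "1 < n" "(p, q) \<in> gen_in_SymSym n (Alt n \<times> Alt n \<union> {(Transposition.transpose 1 2, Transposition.transpose 1 2)})"
  shows "p \<in> Sym n \<and> q \<in> Sym n \<and> (evenperm p \<longleftrightarrow> evenperm q)"
  using assms(2)[unfolded gen_in_SymSym_def]
proof (induction "(p, q)" arbitrary: p q rule: generate.induct)
  case one
  then have "p = id" "q = id" by (simp_all add: DirProd_def sym_group_one)
  then show ?case by (simp only: id_in_Sym)
next
  case (incl p q)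
  then show ?case using \<open>1 < n\<close> by (auto simp: alt_group_carrier sym_group_carrier permutes_swap_id)
next
  case (inv h p q)
  obtain p' q' where h: "h = (p', q')" by (cases h)
  have pq': "p' \<in> Sym n" "q' \<in> Sym n" "evenperm p' \<longleftrightarrow> evenperm q'"
    using inv(1) \<open>1 < n\<close> by (auto simp: h alt_group_carrier sym_group_carrier permutes_swap_id)
  have "(p, q) = (Hilbert_Choice.inv p', Hilbert_Choice.inv q')"
    using inv(2) pq' by (simp add: h inv_DirProd sym_group_is_group)
  then show ?case using pq' sym_group_inv_closed evenperm_inv[OF sym_group_carrier'] by auto
next
  case (eng h1 h2 p q)
  obtain p1 q1 p2 q2 where h: "h1 = (p1, q1)" "h2 = (p2, q2)" by (metis surj_pair)
  have "p = p1 \<circ> p2" "q = q1 \<circ> q2" using eng(5) by (auto simp: h DirProd_def sym_group_mult)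
  then show ?case using eng(2)[OF h(1)] eng(4)[OF h(2)]
    by (auto simp: sym_group_carrier permutes_compose evenperm_comp[OF sym_group_carrier' sym_group_carrier'])
qed

lemma transpositions_in_gen_Alt_Alt:
  assumes "1 < n" "a \<in> {1..n}" "b \<in> {1..n}" "a \<noteq> b" "c \<in> {1..n}" "d \<in> {1..n}" "c \<noteq> d"
  shows "(Transposition.transpose a b, Transposition.transpose c d)
    \<in> gen_in_SymSym n (Alt n \<times> Alt n \<union> {(Transposition.transpose 1 2, Transposition.transpose 1 2)})"
    (is "?t \<in> gen_in_SymSym n (_ \<union> {(?s, ?s)})")
proof -
  have even: "Transposition.transpose i j \<circ> ?s \<in> Alt n" if "i \<in> {1..n}" "j \<in> {1..n}" "i \<noteq> j" for i j
    using that \<open>1 < n\<close> by (auto simp: alt_group_carrier evenperm_comp evenperm_swap permutation_swap_id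
        intro!: permutes_compose permutes_swap_id)
  \<comment> \<open>A pair of odd permutations is a pair of even ones times the odd
    generator.\<close>
  have eq: "?t = (Transposition.transpose a b \<circ> ?s, Transposition.transpose c d \<circ> ?s)
      \<otimes>\<^bsub>DirProd (sym_group n) (sym_group n)\<^esub> (?s, ?s)"
    by (simp add: DirProd_def sym_group_mult comp_assoc)
  have "(Transposition.transpose a b \<circ> ?s, Transposition.transpose c d \<circ> ?s)
      \<otimes>\<^bsub>DirProd (sym_group n) (sym_group n)\<^esub> (?s, ?s)
      \<in> generate (DirProd (sym_group n) (sym_group n)) (Alt n \<times> Alt n \<union> {(?s, ?s)})"
    using assms even by (intro generate.eng generate.incl) auto
  then show ?thesis unfolding gen_in_SymSym_def by (simp only: eq[symmetric])
qed

lemma distinguishing_number_gen_Alt_Alt: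
  assumes n: "n \<ge> 2" and plus: "part_preserving n G
    = bip_perm ` gen_in_SymSym n (Alt n \<times> Alt n \<union> {(Transposition.transpose 1 2, Transposition.transpose 1 2)})"
  shows "distinguishing_number (verts (complete_bipartite n)) G = n"
proof -
  \<comment> \<open>Only one part may repeat a colour. The injective colouring on the left forces
    \<open>p = id\<close>, hence \<open>q\<close> is even and cannot be the transposition of 1 and
    2. Colour 2 is missing on the right, which excludes interchanging elements.\<close>
  define b where "b i = (if i = 2 then 1 else i)" for i :: nat
  have "distinguishing_number (verts (complete_bipartite n)) G = Suc (n - 1)"
  proof (rule distinguishing_number_eq_Suc[where f = "case_sum id b" and l = 1])
    show "case_sum id b x \<in> {1..<1 + Suc (n - 1)}" if "x \<in> both_parts n" for x
      using that n by (auto simp: b_def elim!: both_parts_cases)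
  next
    fix p q assume pq: "bip_perm (p, q) \<in> part_preserving n G" "p permutes {1..n}" "q permutes {1..n}"
      "\<And>i. i \<in> {1..n} \<Longrightarrow> case_sum id b (Inl (p i)) = case_sum id b (Inl i)"
      "\<And>i. i \<in> {1..n} \<Longrightarrow> case_sum id b (Inr (q i)) = case_sum id b (Inr i)"
    have "p = id"
      using pq(2,4) by (auto intro: preserving_injective_eq_id[where f = id])
    moreover have "evenperm p \<longleftrightarrow> evenperm q"
      using gen_Alt_Alt_transposition_even[of p q] pq(1) n by (simp add: plus)
    ultimately have "evenperm q" using evenperm_id by simp
    have "q = id"
    proof (rule even_almost_injective_eq_id[OF pq(3), where f = b and a = 2 and b = 1])
      show "inj_on b ({1..n} - {2})" by (auto simp: inj_on_def b_def)
    qed (use pq(5) n \<open>evenperm q\<close> in \<open>auto simp: b_def\<close>)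
    with \<open>p = id\<close> show "p = id \<and> q = id" ..
  next
    fix x assume x: "x \<in> G" "swaps_sides n x" "\<forall>y\<in>both_parts n. case_sum id b (x y) = case_sum id b y"
    have "card {i \<in> {1..n}. i = 2} \<le> card {i \<in> {1..n}. b i = 2}"
      using swap_preserving_card_le[OF mem_permutes[OF x(1)] x(2,3), of 2] by simp
    also have "{i \<in> {1..n}. i = 2} = {2}" using n by auto
    also have "{i \<in> {1..n}. b i = 2} = {}" by (auto simp: b_def)
    finally show False by simp
  next
    fix a b :: "nat \<Rightarrow> nat"
    assume less: "\<And>i. i \<in> {1..n} \<Longrightarrow> a i < n - 1" "\<And>i. i \<in> {1..n} \<Longrightarrow> b i < n - 1"
    have "card (a ` {1..n}) \<le> card {..<n - 1}" "card (b ` {1..n}) \<le> card {..<n - 1}"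
      using less by (auto intro!: card_mono simp del: atLeastAtMost_iff card_lessThan)
    then have "card (a ` {1..n}) < card {1..n}" "card (b ` {1..n}) < card {1..n}"
      using n by auto
    \<comment> \<open>A single transposition would have unequal signs, so one collision is taken
      from each part and the two transpositions are used together.\<close>
    then obtain i j k l where ijkl: "i \<in> {1..n}" "j \<in> {1..n}" "i \<noteq> j" "a i = a j"
      "k \<in> {1..n}" "l \<in> {1..n}" "k \<noteq> l" "b k = b l"
      by (metis ex_collision)
    show "\<exists>g\<in>G. g \<noteq> id \<and> (\<forall>i\<in>{1..n}. case_sum a b (g (Inl i)) = a i \<and> case_sum a b (g (Inr i)) = b i)"
    proof (rule ex_bip_perm_preserving)
      show "bip_perm (Transposition.transpose i j, Transposition.transpose k l) \<in> part_preserving n G"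
        unfolding plus bip_perm_image_iff by (rule transpositions_in_gen_Alt_Alt) (use n ijkl in auto)
    qed (use ijkl in \<open>simp_all add: transpose_preserves transpose_eq_id_iff\<close>)
  qed (rule not_plus_swaps)
  then show ?thesis using n by simp
qed

end

section \<open>Crown graphs\<close>

text \<open>For injective colourings by pairs. An interchanging element reverses the pairs, so it is
  stopped if \<open>(0, 1)\<close> occurs and \<open>(1, 0)\<close> does not.\<close>

lemma ex_bij_with_value:
  assumes "finite S" "v \<in> S" "w \<notin> S" "1 \<le> m" "m \<le> card S"
  obtains e :: "nat \<Rightarrow> 'a" where "inj_on e {1..m}" "e ` {1..m} \<subseteq> S" "v \<in> e ` {1..m}" "w \<notin> e ` {1..m}"
proof -
  have "m - 1 \<le> card (S - {v})" using assms by simp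
  then obtain T where T: "T \<subseteq> S - {v}" "card T = m - 1"
    by (meson obtain_subset_with_card_n)
  have "finite T" using T(1) \<open>finite S\<close> by (meson finite_Diff finite_subset)
  then have "finite (insert v T)" "card (insert v T) = card {1..m}" using T assms(4) by (auto simp: card_insert_if)
  then obtain e where "bij_betw e {1..m} (insert v T)"
    by (metis finite_same_card_bij finite_atLeastAtMost)
  then have "inj_on e {1..m}" "e ` {1..m} = insert v T" by (auto simp: bij_betw_def)
  with T assms(2,3) show ?thesis by (intro that[of e]) auto
qed

lemma Sym_transitive: "i \<in> {1..n} \<Longrightarrow> j \<in> {1..n} \<Longrightarrow> \<exists>p\<in>Sym n. p i = j"
  by (metis transpose_in_Sym transpose_apply_first)

lemma Alt_transitive:
  assumes "n \<ge> 3" "i \<in> {1..n}" "j \<in> {1..n}"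
  shows "\<exists>p\<in>Alt n. p i = j"
proof (cases "i = j")
  case True
  then show ?thesis by (intro bexI[of _ id]) simp_all
next
  case False
  have "card {i, j} < card {1..n}" using assms(1) card_insert_le_m1[of 2 "{j}" i] by simp
  then have "\<not> {1..n} \<subseteq> {i, j}" by (meson card_mono finite.simps not_le)
  then obtain k where k: "k \<in> {1..n}" "k \<noteq> i" "k \<noteq> j" by blast
  let ?p = "Transposition.transpose i j \<circ> Transposition.transpose j k"
  have "?p \<in> Alt n"
    using assms k False by (auto simp: alt_group_carrier evenperm_comp evenperm_swap permutation_swap_id
        intro!: permutes_compose permutes_swap_id)
  moreover have "?p i = j" using k False by simp
  ultimately show ?thesis by blast
qed

locale index_two_crown = index_two n "crown n" G for n G
begin

lemma not_plus_swaps_if_Diag: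
  assumes plus: "part_preserving n G = bip_perm ` Diag H"
    and trans: "\<And>i j. i \<in> {1..n} \<Longrightarrow> j \<in> {1..n} \<Longrightarrow> \<exists>h\<in>H. h i = j"
    and x: "x \<in> G" "x \<notin> part_preserving n G"
  shows "swaps_sides n x"
proof (rule not_plus_swaps_if_transitive[OF _ x])
  fix i j assume "i \<in> {1..n}" "j \<in> {1..n}"
  then obtain h where "h \<in> H" "h i = j" using trans by blast
  then show "\<exists>g\<in>part_preserving n G. g (Inl i) = Inl j"
    unfolding plus by (intro bexI[of _ "bip_perm (h, h)"]) (auto simp: Diag_twisted_def)
qed

text \<open>The vertex \<open>u\<^sub>i\<close> is the only one in the right part that is not adjacent to \<open>v\<^sub>i\<close>.\<close>

lemma swap_obtains_permutation:
  assumes x: "x \<in> G" "swaps_sides n x"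
  obtains s where "s \<in> Sym n" "\<And>i. i \<in> {1..n} \<Longrightarrow> x (Inl i) = Inr (s i) \<and> x (Inr i) = Inl (s i)"
proof -
  note p = mem_permutes[OF x(1)]
  define s where "s i = (if i \<in> {1..n} then projr (x (Inl i)) else i)" for i
  have s: "s i \<in> {1..n} \<and> x (Inl i) = Inr (s i) \<and> x (Inr i) = Inl (s i)" if i: "i \<in> {1..n}" for i
  proof -
    have "\<not> isl (x (Inl i))" "isl (x (Inr i))"
      using x(2) i by (auto simp: swaps_sides_def ball_both_parts)
    then obtain j k where jk: "x (Inl i) = Inr j" "x (Inr i) = Inl k"
      unfolding isl_def by (metis obj_sumE)
    have "j \<in> {1..n}" "k \<in> {1..n}"
      using permutes_both_partsD[OF p, of "Inl i"] permutes_both_partsD[OF p, of "Inr i"] i jk by auto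
    have "{Inl i, Inr i} \<notin> edges (crown n)" using i by (auto simp: crown_def)
    then have "{Inl k, Inr j} \<notin> edges (crown n)"
      using mem_edges[OF x(1), of "Inl i" "Inr i"] i jk by (simp add: insert_commute)
    then have "k = j"
      using \<open>j \<in> {1..n}\<close> \<open>k \<in> {1..n}\<close>
      by (auto simp: crown_def complete_bipartite_def doubleton_eq_iff)
    then show ?thesis using jk \<open>j \<in> {1..n}\<close> i by (simp add: s_def)
  qed
  moreover have "s permutes {1..n}"
  proof (rule inj_imp_permutes)
    show "inj_on s {1..n}"
      by (rule inj_onI) (metis s permutes_inj[OF p] injD sum.inject(1))
  qed (use s in \<open>auto simp: s_def\<close>)
  ultimately show ?thesis using that by (simp add: sym_group_carrier)
qed

lemma distinguishing_number_Diag_Sym: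
  assumes plus: "part_preserving n G = bip_perm ` Diag (Sym n)"
  shows "int (distinguishing_number (verts (crown n)) G) = \<lfloor>sqrt (real n)\<rfloor> + 1"
proof -
  define m where "m = nat \<lfloor>sqrt (real n)\<rfloor>"
  have m_int: "int m = \<lfloor>sqrt (real n)\<rfloor>" by (simp add: m_def)
  have "real m \<le> sqrt (real n)" "sqrt (real n) < real m + 1"
    using m_int by linarith+
  then have "(real m)\<^sup>2 \<le> (sqrt (real n))\<^sup>2" "(sqrt (real n))\<^sup>2 < (real m + 1)\<^sup>2"
    by (intro power_mono power_strict_mono; simp)+
  then have "real (m\<^sup>2) \<le> real n" "real n < real ((m + 1)\<^sup>2)" by (simp_all add: add.commute)
  then have m: "m\<^sup>2 \<le> n" "n < (m + 1)\<^sup>2" unfolding of_nat_le_iff of_nat_less_iff by auto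
  have "m \<noteq> 0" using m n_pos by (intro notI) simp
  \<comment> \<open>Because \<open>n < (m + 1)\<^sup>2\<close>, the square of all pairs has room for
    \<open>n\<close> points even without \<open>(1, 0)\<close>.\<close>
  define S where "S = {..<Suc m} \<times> {..<Suc m} - {(1::nat, 0::nat)}"
  have "card S = (m + 1)\<^sup>2 - 1" using \<open>m \<noteq> 0\<close> by (simp add: S_def card_cartesian_product power2_eq_square)
  then have "n \<le> card S" using m by simp
  moreover have "finite S" "(0, 1) \<in> S" "(1, 0) \<notin> S" using \<open>m \<noteq> 0\<close> by (auto simp: S_def)
  ultimately obtain e where e: "inj_on e {1..n}" "e ` {1..n} \<subseteq> S" "(0, 1) \<in> e ` {1..n}" "(1, 0) \<notin> e ` {1..n}"
    using ex_bij_with_value[of S "(0, 1)" "(1, 0)" n] n_pos by auto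
  have "distinguishing_number (verts (crown n)) G = Suc m"
  proof (rule distinguishing_number_eq_Suc[where f = "case_sum (fst \<circ> e) (snd \<circ> e)" and l = 0])
    show "case_sum (fst \<circ> e) (snd \<circ> e) x \<in> {0..<0 + Suc m}" if "x \<in> both_parts n" for x
      using that
    proof (cases rule: both_parts_cases)
      case (1 i)
      then have "e i \<in> S" using e(2) by blast
      then show ?thesis using 1 by (auto simp: S_def)
    next
      case (2 i)
      then have "e i \<in> S" using e(2) by blast
      then show ?thesis using 2 by (auto simp: S_def)
    qed
  next
    show "swaps_sides n x" if "x \<in> G" "x \<notin> part_preserving n G" for x
      by (rule not_plus_swaps_if_Diag[OF plus Sym_transitive that])
  next
    fix p q assume pq: "bip_perm (p, q) \<in> part_preserving n G" "p permutes {1..n}"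
      "\<And>i. i \<in> {1..n} \<Longrightarrow> case_sum (fst \<circ> e) (snd \<circ> e) (Inl (p i)) = case_sum (fst \<circ> e) (snd \<circ> e) (Inl i)"
      "\<And>i. i \<in> {1..n} \<Longrightarrow> case_sum (fst \<circ> e) (snd \<circ> e) (Inr (q i)) = case_sum (fst \<circ> e) (snd \<circ> e) (Inr i)"
    have "q = p" using pq(1) by (auto simp: plus Diag_twisted_def)
    moreover have "p = id"
      using pq \<open>q = p\<close> e(1) by (intro preserving_injective_eq_id[where f = e]) (auto simp: prod_eq_iff)
    ultimately show "p = id \<and> q = id" by simp
  next
    fix x assume x: "x \<in> G" "swaps_sides n x"
      and pres: "\<forall>y\<in>both_parts n. case_sum (fst \<circ> e) (snd \<circ> e) (x y) = case_sum (fst \<circ> e) (snd \<circ> e) y"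
    obtain s where s: "s \<in> Sym n" "\<And>i. i \<in> {1..n} \<Longrightarrow> x (Inl i) = Inr (s i) \<and> x (Inr i) = Inl (s i)"
      using swap_obtains_permutation[OF x] by blast
    obtain i where i: "i \<in> {1..n}" "e i = (0, 1)" using e(3) by force
    have "snd (e (s i)) = 0" "fst (e (s i)) = 1"
      using bspec[OF pres, of "Inl i"] bspec[OF pres, of "Inr i"] s(2)[OF i(1)] i by simp_all
    then have "e (s i) = (1, 0)" by (simp add: prod_eq_iff)
    moreover have "s i \<in> {1..n}" using s(1) i(1) by (simp add: sym_group_carrier permutes_in_image del: atLeastAtMost_iff)
    ultimately show False using e(4) by (metis imageI)
  next
    fix a b :: "nat \<Rightarrow> nat"
    assume less: "\<And>i. i \<in> {1..n} \<Longrightarrow> a i < m" "\<And>i. i \<in> {1..n} \<Longrightarrow> b i < m"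
    define c where "c i = (a i, b i)" for i
    show "\<exists>g\<in>G. g \<noteq> id \<and> (\<forall>i\<in>{1..n}. case_sum a b (g (Inl i)) = a i \<and> case_sum a b (g (Inr i)) = b i)"
    proof (cases "inj_on c {1..n}")
      case False
      then obtain i j where ij: "i \<in> {1..n}" "j \<in> {1..n}" "i \<noteq> j" "a i = a j" "b i = b j"
        by (auto simp: inj_on_def c_def)
      then show ?thesis
        by (intro ex_bip_perm_preserving[of "Transposition.transpose i j" "Transposition.transpose i j"])
          (auto simp: plus Diag_twisted_def transpose_preserves transpose_eq_id_iff transpose_in_Sym)
    next
      case True
      \<comment> \<open>Injectivity is possible only if \<open>n = m\<^sup>2\<close>, and then every
        pair of colours occurs; \<open>t\<close> sends each point to the one with the reversed
        pair.\<close>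
      have sub: "c ` {1..n} \<subseteq> {..<m} \<times> {..<m}" using less by (auto simp: c_def)
      have "card ({..<m} \<times> {..<m}) \<le> card (c ` {1..n})"
        using m(1) True by (simp add: card_image card_cartesian_product power2_eq_square)
      then have img: "c ` {1..n} = {..<m} \<times> {..<m}" using sub by (intro card_seteq) auto
      define t where "t i = (if i \<in> {1..n} then inv_into {1..n} c (b i, a i) else i)" for i
      have t: "t i \<in> {1..n}" "a (t i) = b i" "b (t i) = a i" if i: "i \<in> {1..n}" for i
      proof -
        have "(b i, a i) \<in> c ` {1..n}" unfolding img using less i by simp
        then have "inv_into {1..n} c (b i, a i) \<in> {1..n}" "c (inv_into {1..n} c (b i, a i)) = (b i, a i)"
          by (rule inv_into_into, rule f_inv_into_f)
        then show "t i \<in> {1..n}" "a (t i) = b i" "b (t i) = a i"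
          unfolding t_def using i by (simp_all add: c_def)
      qed
      have "t permutes {1..n}"
      proof (rule inj_imp_permutes)
        show "inj_on t {1..n}"
        proof (rule inj_onI)
          fix i j assume ij: "i \<in> {1..n}" "j \<in> {1..n}" "t i = t j"
          then have "c i = c j" using t[OF ij(1)] t[OF ij(2)] by (simp add: c_def)
          then show "i = j" using True ij by (auto dest: inj_onD)
        qed
      qed (use t(1) in \<open>auto simp: t_def\<close>)
      obtain x where "x \<in> G" "x \<notin> part_preserving n G" by (rule ex_not_plus)
      moreover have "swaps_sides n x"
        by (rule not_plus_swaps_if_Diag[OF plus Sym_transitive calculation])
      ultimately obtain s where s: "s \<in> Sym n"
        "\<And>i. i \<in> {1..n} \<Longrightarrow> x (Inl i) = Inr (s i) \<and> x (Inr i) = Inl (s i)"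
        using swap_obtains_permutation by blast
      \<comment> \<open>The given interchanging element acts on the indices by \<open>s\<close>; the
        diagonal element of \<open>?h\<close> corrects this to \<open>t\<close>. Reversing the pairs
        and interchanging the parts cancel, so colours are preserved.\<close>
      let ?h = "Hilbert_Choice.inv s \<circ> t"
      let ?g = "x \<circ> bip_perm (?h, ?h)"
      have s': "s permutes {1..n}" using s(1) by (simp add: sym_group_carrier)
      have h: "?h permutes {1..n}"
        using permutes_compose[OF \<open>t permutes {1..n}\<close> permutes_inv[OF s']] .
      then have "bip_perm (?h, ?h) \<in> part_preserving n G"
        unfolding plus by (auto simp: Diag_twisted_def sym_group_carrier)
      then have "?g \<in> G" using comp_mem[OF \<open>x \<in> G\<close>] by (simp add: plus_iff)
      moreover have g: "?g (Inl i) = Inr (t i)" "?g (Inr i) = Inl (t i)" if i: "i \<in> {1..n}" for i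
      proof -
        have "?h i \<in> {1..n}" using h i by (simp only: permutes_in_image)
        from s(2)[OF this] show "?g (Inl i) = Inr (t i)" "?g (Inr i) = Inl (t i)"
          by (simp_all add: permutes_inverses(1)[OF s'])
      qed
      moreover have "?g \<noteq> id"
      proof
        assume "?g = id"
        with g(1)[of 1] show False using n_pos by simp
      qed
      ultimately show ?thesis using t by (intro bexI[of _ ?g]) (auto simp del: comp_apply atLeastAtMost_iff)
    qed
  qed
  then show ?thesis using m_int by simp
qed

lemma distinguishing_number_Diag_Alt:
  assumes n: "n \<ge> 3" and plus: "part_preserving n G = bip_perm ` Diag (Alt n)"
  shows "int (distinguishing_number (verts (crown n)) G) = \<lceil>sqrt (real n - 1)\<rceil>"
proof -
  define k where "k = nat \<lceil>sqrt (real n - 1)\<rceil>"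
  have root: "1 < sqrt (real n - 1)" using n by simp
  have "0 \<le> \<lceil>sqrt (real n - 1)\<rceil>" using root by linarith
  then have k_int: "int k = \<lceil>sqrt (real n - 1)\<rceil>" by (simp add: k_def)
  have k_real: "real k - 1 < sqrt (real n - 1)" "sqrt (real n - 1) \<le> real k"
    using k_int by linarith+
  define m where "m = k - 1"
  \<comment> \<open>At least two colours are available, so \<open>(0, 1)\<close> is an admissible
    pair.\<close>
  have "real k > 1" using k_real root by linarith
  then have k: "k = Suc m" "m \<noteq> 0" by (auto simp: m_def)
  have "(real m)\<^sup>2 < (sqrt (real n - 1))\<^sup>2"
    using k_real k by (intro power_strict_mono) auto
  moreover have "(sqrt (real n - 1))\<^sup>2 \<le> (real k)\<^sup>2"
    using k_real root by (intro power_mono) auto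
  moreover have "(sqrt (real n - 1))\<^sup>2 = real n - 1" using n by simp
  ultimately have "real (m\<^sup>2 + 1) < real n" "real n \<le> real (k\<^sup>2 + 1)" by simp_all
  \<comment> \<open>The strict bound from the ceiling gives the two spare points that
    \<open>ex_even_preserving\<close> asks for; the other bound provides distinct pairs for all
    points but one.\<close>
  then have m: "m\<^sup>2 + 2 \<le> n" "n - 1 \<le> (Suc m)\<^sup>2"
    unfolding of_nat_le_iff of_nat_less_iff k by auto
  obtain e0 where e0: "inj_on e0 {1..n - 1}" "e0 ` {1..n - 1} \<subseteq> {..<Suc m} \<times> {..<Suc m}"
    "(0::nat, 1::nat) \<in> e0 ` {1..n - 1}"
  proof (rule ex_bij_with_value[of _ "(0, 1)"])
    show "n - 1 \<le> card ({..<Suc m} \<times> {..<Suc m})"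
      using m(2) by (simp add: card_cartesian_product power2_eq_square)
    \<comment> \<open>The value to be avoided is taken outside the square: here the symmetry is
      broken by repeating \<open>(0, 1)\<close>, not by omitting \<open>(1, 0)\<close>.\<close>
    show "(Suc m, 0) \<notin> {..<Suc m} \<times> {..<Suc m}" by simp
  qed (use n \<open>m \<noteq> 0\<close> in auto)
  then obtain r where r: "r \<in> {1..n - 1}" "e0 r = (0, 1)" by force
  \<comment> \<open>The point \<open>n\<close> repeats the pair of \<open>r\<close>. The
    transposition of the two is odd, and an interchanging element would send both to points with the
    pair \<open>(1, 0)\<close>, which occurs at most once.\<close>
  define e where "e i = (if i = n then (0, 1) else e0 i)" for i
  have e: "inj_on e ({1..n} - {n})" "e ` {1..n} \<subseteq> {..<Suc m} \<times> {..<Suc m}" "e n = (0, 1)" "e r = (0, 1)"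
    "r \<in> {1..n}" "r \<noteq> n"
  proof -
    show "inj_on e ({1..n} - {n})"
      using e0(1) by (auto simp: inj_on_def e_def)
    have "e0 i \<in> {..<Suc m} \<times> {..<Suc m}" if "i \<in> {1..n}" "i \<noteq> n" for i
      using e0(2) that by (auto simp: image_subset_iff)
    then show "e ` {1..n} \<subseteq> {..<Suc m} \<times> {..<Suc m}"
      using \<open>m \<noteq> 0\<close> by (auto simp: e_def image_subset_iff)
  qed (use r n in \<open>auto simp: e_def\<close>)
  have "distinguishing_number (verts (crown n)) G = Suc m"
  proof (rule distinguishing_number_eq_Suc[where f = "case_sum (fst \<circ> e) (snd \<circ> e)" and l = 0])
    show "case_sum (fst \<circ> e) (snd \<circ> e) x \<in> {0..<0 + Suc m}" if "x \<in> both_parts n" for x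
      using that
    proof (cases rule: both_parts_cases)
      case (1 i)
      then have "e i \<in> {..<Suc m} \<times> {..<Suc m}" using e(2) by blast
      then show ?thesis using 1 by auto
    next
      case (2 i)
      then have "e i \<in> {..<Suc m} \<times> {..<Suc m}" using e(2) by blast
      then show ?thesis using 2 by auto
    qed
  next
    show "swaps_sides n x" if "x \<in> G" "x \<notin> part_preserving n G" for x
      by (rule not_plus_swaps_if_Diag[OF plus Alt_transitive[OF n] that])
  next
    fix p q assume pq: "bip_perm (p, q) \<in> part_preserving n G" "p permutes {1..n}"
      "\<And>i. i \<in> {1..n} \<Longrightarrow> case_sum (fst \<circ> e) (snd \<circ> e) (Inl (p i)) = case_sum (fst \<circ> e) (snd \<circ> e) (Inl i)"
      "\<And>i. i \<in> {1..n} \<Longrightarrow> case_sum (fst \<circ> e) (snd \<circ> e) (Inr (q i)) = case_sum (fst \<circ> e) (snd \<circ> e) (Inr i)"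
    have qp: "q = p" "evenperm p" using pq(1) by (auto simp: plus Diag_twisted_def alt_group_carrier)
    moreover have "p = id"
    proof (rule even_almost_injective_eq_id[OF pq(2) e(1)])
      show "e n = e r" using e by simp
      show "e (p i) = e i" if "i \<in> {1..n}" for i
        using pq(3,4)[OF that] qp by (simp add: prod_eq_iff)
    qed (use e qp in auto)
    ultimately show "p = id \<and> q = id" by simp
  next
    fix x assume x: "x \<in> G" "swaps_sides n x"
      and pres: "\<forall>y\<in>both_parts n. case_sum (fst \<circ> e) (snd \<circ> e) (x y) = case_sum (fst \<circ> e) (snd \<circ> e) y"
    obtain s where s: "s \<in> Sym n" "\<And>i. i \<in> {1..n} \<Longrightarrow> x (Inl i) = Inr (s i) \<and> x (Inr i) = Inl (s i)"
      using swap_obtains_permutation[OF x] by blast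
    then have s': "s permutes {1..n}" by (simp add: sym_group_carrier)
    have swapped: "e (s i) = (1, 0)" "s i \<in> {1..n} - {n}" if i: "i \<in> {1..n}" "e i = (0, 1)" for i
    proof -
      have "snd (e (s i)) = 0" "fst (e (s i)) = 1"
        using bspec[OF pres, of "Inl i"] bspec[OF pres, of "Inr i"] s(2)[OF i(1)] i by simp_all
      then show *: "e (s i) = (1, 0)" by (simp add: prod_eq_iff)
      show "s i \<in> {1..n} - {n}"
        using s' i(1) * e(3) by (auto simp: permutes_in_image simp del: atLeastAtMost_iff)
    qed
    have "n \<in> {1..n}" using n by simp
    then have "s n = s r"
      using e swapped[of n] swapped[of r] by (intro inj_onD[OF e(1)]) auto
    then show False using permutes_inj[OF s'] e(6) by (auto dest: injD)
  next
    fix a b :: "nat \<Rightarrow> nat"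
    assume less: "\<And>i. i \<in> {1..n} \<Longrightarrow> a i < m" "\<And>i. i \<in> {1..n} \<Longrightarrow> b i < m"
    define c where "c i = (a i, b i)" for i
    have "card (c ` {1..n}) \<le> card ({..<m} \<times> {..<m})"
      using less by (intro card_mono) (auto simp: c_def)
    then have "card (c ` {1..n}) + 2 \<le> n"
      using m(1) by (simp add: card_cartesian_product power2_eq_square)
    then obtain p where p: "p \<in> Alt n" "p \<noteq> id" "\<And>i. c (p i) = c i" using ex_even_preserving by blast
    then show "\<exists>g\<in>G. g \<noteq> id \<and> (\<forall>i\<in>{1..n}. case_sum a b (g (Inl i)) = a i \<and> case_sum a b (g (Inr i)) = b i)"
      by (intro ex_bip_perm_preserving[of p p]) (auto simp: plus Diag_twisted_def c_def)
  qed
  then show ?thesis using k_int k by simp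
qed

end

section \<open>Automorphisms of symmetric groups\<close>

text \<open>Such an involution is the product of the three transpositions of a point of
  \<open>{x, y, z}\<close> with its image.\<close>

lemma odd_if_swaps_halves:
  fixes p :: "'a \<Rightarrow> 'a"
  assumes p: "p permutes {x, y, z} \<union> p ` {x, y, z}" "p \<circ> p = id"
    and disj: "{x, y, z} \<inter> p ` {x, y, z} = {}" "x \<noteq> y" "x \<noteq> z" "y \<noteq> z"
  shows "\<not> evenperm p"
proof -
  let ?t = "\<lambda>i. Transposition.transpose i (p i)"
  have pp: "p (p i) = i" for i using fun_cong[OF p(2), of i] by simp
  have inj: "p i = p j \<longleftrightarrow> i = j" for i j using pp by metis
  have neq: "p x \<noteq> x" "p x \<noteq> y" "p x \<noteq> z" "p y \<noteq> x" "p y \<noteq> y" "p y \<noteq> z" "p z \<noteq> x" "p z \<noteq> y" "p z \<noteq> z"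
    using disj(1) by auto
  have "p = ?t x \<circ> (?t y \<circ> ?t z)"
  proof
    fix i
    show "p i = (?t x \<circ> (?t y \<circ> ?t z)) i"
    proof (cases "i \<in> {x, y, z} \<union> p ` {x, y, z}")
      case True
      then consider "i = x" | "i = y" | "i = z" | "i = p x" | "i = p y" | "i = p z" by blast
      then show ?thesis
        using neq neq[symmetric] disj(2-4) disj(2-4)[symmetric]
        by cases (simp_all add: pp inj)
    next
      case False
      then have "p i = i" by (rule permutes_not_in[OF p(1)])
      then show ?thesis using False by simp
    qed
  qed
  moreover have "\<not> evenperm (?t x \<circ> (?t y \<circ> ?t z))"
    using neq neq[symmetric]
    by (simp add: evenperm_comp evenperm_swap permutation_compose permutation_swap_id del: o_apply)
  ultimately show ?thesis by simp
qed

locale sym_group_aut =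
  fixes n :: nat and \<phi> :: "(nat \<Rightarrow> nat) \<Rightarrow> nat \<Rightarrow> nat"
  assumes aut: "\<phi> \<in> auto (sym_group n)"
begin

lemma mem: "h \<in> Sym n \<Longrightarrow> \<phi> h \<in> Sym n"
  and hom: "h \<in> Sym n \<Longrightarrow> k \<in> Sym n \<Longrightarrow> \<phi> (h \<circ> k) = \<phi> h \<circ> \<phi> k"
  and inj: "inj_on \<phi> (Sym n)"
  using aut by (auto simp: auto_def hom_def Bij_def bij_betw_def sym_group_mult)

lemma permutes: "h \<in> Sym n \<Longrightarrow> \<phi> h permutes {1..n}"
  using mem by (simp add: sym_group_carrier)

lemma map_id: "\<phi> id = id"
proof -
  have "\<phi> id \<circ> \<phi> id = \<phi> id \<circ> id" using hom[of id id] by simp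
  moreover have "inj (\<phi> id)" using permutes[of id] permutes_inj by simp
  ultimately show ?thesis by (metis fun.inj_map_strong id_comp inj_on_def comp_id injD o_apply eq_id_iff)
qed

lemma map_inv:
  assumes "h \<in> Sym n"
  shows "\<phi> (Hilbert_Choice.inv h) = Hilbert_Choice.inv (\<phi> h)"
proof -
  have "h \<circ> Hilbert_Choice.inv h = id" "Hilbert_Choice.inv h \<circ> h = id"
    using assms permutes_inv_o by (auto simp: sym_group_carrier)
  then have "\<phi> h \<circ> \<phi> (Hilbert_Choice.inv h) = id" "\<phi> (Hilbert_Choice.inv h) \<circ> \<phi> h = id"
    using hom[OF assms sym_group_inv_closed[OF assms]] hom[OF sym_group_inv_closed[OF assms] assms] map_id
    by simp_all
  then show ?thesis by (rule inv_unique_comp[symmetric])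
qed

text \<open>The image of a three-cycle is even because the cube of its sign is 1.\<close>

lemma even_image:
  assumes "h \<in> Alt n"
  shows "\<phi> h \<in> Alt n"
proof -
  interpret A: group "alt_group n" by (rule alt_group_is_group)
  have closed: "x \<in> Sym n" if "x \<in> generate (alt_group n) (three_cycles n)" for x
    using that Alt_imp_Sym unfolding alt_group_carrier_as_three_cycles by blast
  have perm: "permutation (\<phi> x)" if "x \<in> Sym n" for x
    using mem[OF that] by (rule sym_group_carrier')
  have three: "evenperm (\<phi> x)" if x: "x \<in> three_cycles n" for x
  proof -
    obtain cs where cs: "x = cycle_of_list cs" "cycle cs" "length cs = 3" using x by blast
    obtain a b c where abc: "cs = [a, b, c]" using stupid_lemma[OF cs(3)] by blast
    have dist: "a \<noteq> b" "a \<noteq> c" "b \<noteq> c" using cs(2) by (auto simp: abc)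
    have "x \<circ> (x \<circ> x) = id"
      using dist by (auto simp: cs(1) abc fun_eq_iff Transposition.transpose_def)
    moreover have X: "x \<in> Sym n" using x three_cycles_incl by (blast intro: Alt_imp_Sym)
    moreover from this have "x \<circ> x \<in> Sym n" by (simp add: sym_group_carrier permutes_compose)
    ultimately have "\<phi> x \<circ> (\<phi> x \<circ> \<phi> x) = id" using hom map_id by metis
    then have "sign (\<phi> x \<circ> (\<phi> x \<circ> \<phi> x)) = 1" by (simp only: sign_id)
    then have "sign (\<phi> x) * (sign (\<phi> x) * sign (\<phi> x)) = 1"
      using perm[OF X] by (simp add: sign_compose permutation_compose del: o_apply)
    then show ?thesis by (simp add: sign_def split: if_splits)
  qed
  have "evenperm (\<phi> h)"
    using assms unfolding alt_group_carrier_as_three_cycles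
  proof (induction rule: generate.induct)
    case one
    show ?case by (simp only: alt_group_one map_id evenperm_id)
  next
    case (incl h)
    then show ?case by (rule three)
  next
    case (inv h)
    then have h: "h \<in> Alt n" using three_cycles_incl by blast
    then have "h \<in> Sym n" using Alt_imp_Sym by blast
    then show ?case
      using three[OF inv] perm by (simp add: alt_group_inv_equality[OF h] map_inv evenperm_inv)
  next
    case (eng h1 h2)
    then have S: "h1 \<in> Sym n" "h2 \<in> Sym n" using closed by blast+
    show ?case unfolding alt_group_mult hom[OF S] evenperm_comp[OF perm[OF S(1)] perm[OF S(2)]]
      using eng by simp
  qed
  moreover have "h \<in> Sym n" using assms Alt_imp_Sym by blast
  ultimately show ?thesis using permutes by (simp add: alt_group_carrier)
qed

text \<open>This is the orbit map of \<open>(A, C)\<close>, where \<open>Alt n\<close> acts on the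
  second set through \<open>\<phi>\<close>. Two elements with the same value differ by an element of
  the stabiliser.\<close>

lemma inj_on_pair_action:
  assumes "A \<subseteq> {1..n}" "C \<subseteq> {1..n}"
    and triv: "\<And>h. h \<in> Alt n \<Longrightarrow> h ` A = A \<Longrightarrow> \<phi> h ` C = C \<Longrightarrow> h = id"
  shows "inj_on (\<lambda>h. (h ` A, \<phi> h ` C)) (Alt n)"
proof (rule inj_onI, clarsimp)
  fix g h assume gh: "g \<in> Alt n" "h \<in> Alt n" "g ` A = h ` A" "\<phi> g ` C = \<phi> h ` C"
  let ?k = "Hilbert_Choice.inv h \<circ> g"
  have S: "g \<in> Sym n" "h \<in> Sym n" using gh Alt_imp_Sym by auto
  note p = S(2)[unfolded sym_group_carrier] permutes[OF S(2)]
  have "?k ` A = A"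
    by (simp only: image_comp[symmetric] gh(3)) (simp add: image_comp permutes_inv_o(2)[OF p(1)])
  moreover have "\<phi> ?k = Hilbert_Choice.inv (\<phi> h) \<circ> \<phi> g"
    using hom[OF sym_group_inv_closed] map_inv S by simp
  then have "\<phi> ?k ` C = C"
    by (simp only: image_comp[symmetric] gh(4)) (simp add: image_comp permutes_inv_o(2)[OF p(2)])
  moreover have "?k \<in> Alt n"
    using alt_group_inv_closed[OF gh(2)] gh(1) alt_group_carrier'
    by (auto simp: alt_group_carrier permutes_compose evenperm_comp)
  ultimately have "?k = id" using triv by blast
  then have "h \<circ> ?k = h" by simp
  then show "g = h" by (simp add: comp_assoc[symmetric] permutes_inv_o(1)[OF p(1)])
qed

end

section \<open>Colourings of two copies of six points\<close>

text \<open>If the stabiliser in \<open>Alt 6\<close> of the pair \<open>(A, B)\<close> is trivial, then its orbit has 360 elements,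
  which leaves only the case that \<open>A\<close> and \<open>B\<close> have three elements. There are 400 pairs of this kind, so
  the orbits of \<open>(A, B)\<close> and \<open>(A, - B)\<close> meet, and we obtain \<open>h\<close> fixing \<open>A\<close> such that \<open>\<phi> h\<close> interchanges
  \<open>B\<close> and \<open>- B\<close>. It is an involution, and a product of three transpositions, although it is even.\<close>

lemma ex_Alt6_preserving:
  assumes aut: "\<phi> \<in> auto (sym_group 6)" and sub: "A \<subseteq> {1..6}" "B \<subseteq> {1..6}"
  obtains h where "h \<in> Alt 6" "h \<noteq> id" "h ` A = A" "\<phi> h ` B = B"
proof (rule ccontr)
  assume "\<not> thesis"
  with that have triv: "h = id" if "h \<in> Alt 6" "h ` A = A" "\<phi> h ` B = B" for h using that by blast
  interpret sym_group_aut 6 \<phi> by unfold_locales (rule aut)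
  define F where "F C h = (h ` A, \<phi> h ` C)" for C h
  define S where "S = {X. X \<subseteq> {1..6::nat} \<and> card X = card A} \<times> {Y. Y \<subseteq> {1..6::nat} \<and> card Y = card B}"
  have card_S: "card S = (6 choose card A) * (6 choose card B)" and fin_S: "finite S"
    by (simp_all add: S_def card_cartesian_product n_subsets)
  have card_Alt: "card (Alt 6) = 360"
    using alt_group_card_carrier[of 6] by (simp add: fact_numeral)
  have image: "k ` X \<subseteq> {1..6}" "card (k ` X) = card X" if "X \<subseteq> {1..6}" "k permutes {1..6}" for k X
    using that permutes_in_image[OF that(2)] card_image[OF permutes_inj_on[OF that(2)]] by blast+
  have F_S: "F C ` Alt 6 \<subseteq> S" if "C \<subseteq> {1..6}" "card C = card B" for C
  proof
    fix w assume "w \<in> F C ` Alt 6"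
    then obtain h where h: "h \<in> Alt 6" "w = (h ` A, \<phi> h ` C)" by (auto simp: F_def)
    then have "h \<in> Sym 6" by (simp add: Alt_imp_Sym)
    with image[OF sub(1), of h] image[OF that(1) permutes[of h]] that(2)
    show "w \<in> S" by (simp add: S_def h(2) sym_group_carrier)
  qed
  have F_card: "card (F B ` Alt 6) = 360"
  proof -
    have "inj_on (F B) (Alt 6)"
      unfolding F_def by (rule inj_on_pair_action[OF sub]) (rule triv)
    then show ?thesis using card_Alt by (simp only: card_image)
  qed
  \<comment> \<open>The binomial coefficients are 1, 6, 15 and 20. As \<open>15 * 20 = 300\<close>,
    only \<open>20 * 20 = 400\<close> reaches 360.\<close>
  then have "360 \<le> (6 choose card A) * (6 choose card B)"
    using card_mono[OF fin_S F_S[OF sub(2)]] card_S by simp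
  moreover have "card A \<le> 6" "card B \<le> 6"
    using card_mono[OF _ sub(1)] card_mono[OF _ sub(2)] by simp_all
  then have "card A \<in> {0, 1, 2, 3, 4, 5, 6}" "card B \<in> {0, 1, 2, 3, 4, 5, 6}" by auto
  ultimately have three: "card A = 3" "card B = 3"
    by (auto simp: numeral_eq_Suc)
  define B' where "B' = {1..6} - B"
  have B': "B' \<subseteq> {1..6}" "card B' = card B"
    using card_Diff_subset[OF _ sub(2)] finite_subset[OF sub(2)] three by (simp_all add: B'_def)
  have compl: "k ` B' = {1..6} - k ` B" if "k permutes {1..6}" for k
    unfolding B'_def using permutes_image[OF that] permutes_inj[OF that] by (simp add: image_set_diff)
  \<comment> \<open>A permutation of the six points stabilises a set exactly if it stabilises the
    complement, so the second orbit has 360 elements too, and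
    \<open>360 + 360 > 400\<close>.\<close>
  have triv': "h = id" if h: "h \<in> Alt 6" "h ` A = A" "\<phi> h ` B' = B'" for h
  proof (rule triv[OF h(1,2)])
    have "h \<in> Sym 6" using h Alt_imp_Sym by blast
    note p = permutes[OF this]
    have "\<phi> h ` B \<subseteq> {1..6}" using image[OF sub(2) p] by blast
    then have "\<phi> h ` B = {1..6} - \<phi> h ` B'" using compl[OF p] by blast
    also have "\<dots> = B" using h(3) sub(2) by (auto simp: B'_def)
    finally show "\<phi> h ` B = B" .
  qed
  have F_card': "card (F B' ` Alt 6) = 360"
  proof -
    have "inj_on (F B') (Alt 6)"
      unfolding F_def by (rule inj_on_pair_action[OF sub(1) B'(1)]) (rule triv')
    then show ?thesis using card_Alt by (simp only: card_image)
  qed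
  have "card (F B ` Alt 6 \<union> F B' ` Alt 6) \<le> card S"
    using F_S[OF sub(2)] F_S[OF B'] fin_S by (intro card_mono) auto
  also have "card S = 400" using card_S three by (simp add: numeral_eq_Suc)
  finally have "F B ` Alt 6 \<inter> F B' ` Alt 6 \<noteq> {}"
    using F_card F_card' card_Un_disjoint[of "F B ` Alt 6" "F B' ` Alt 6"]
      finite_subset[OF F_S[OF sub(2)] fin_S] finite_subset[OF F_S[OF B'] fin_S] by auto
  then obtain g k where gk: "g \<in> Alt 6" "k \<in> Alt 6" "g ` A = k ` A" "\<phi> g ` B = \<phi> k ` B'"
    by (auto simp: F_def)
  define h where "h = Hilbert_Choice.inv k \<circ> g"
  have S: "g \<in> Sym 6" "k \<in> Sym 6" using gk Alt_imp_Sym by auto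
  have h: "h \<in> Alt 6"
    unfolding h_def using alt_group_inv_closed[OF gk(2)] gk(1) alt_group_carrier'
    by (auto simp: alt_group_carrier permutes_compose evenperm_comp)
  then have hS: "h \<in> Sym 6" using Alt_imp_Sym by blast
  have hA: "h ` A = A"
    unfolding h_def by (simp only: image_comp[symmetric] gk(3))
      (use S(2) in \<open>simp add: image_comp permutes_inv_o(2) sym_group_carrier\<close>)
  have "\<phi> h = Hilbert_Choice.inv (\<phi> k) \<circ> \<phi> g"
    unfolding h_def using hom[OF sym_group_inv_closed] map_inv S by simp
  then have hB: "\<phi> h ` B = B'"
    by (simp only: image_comp[symmetric] gk(4))
      (simp add: image_comp permutes_inv_o(2)[OF permutes[OF S(2)]])
  then have "\<phi> h ` B' = B"
    using compl[OF permutes[OF hS]] sub(2) by (auto simp: B'_def)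
  \<comment> \<open>The square of \<open>h\<close> stabilises \<open>A\<close>, and its image under
    \<open>\<phi>\<close> brings \<open>B\<close> back to itself.\<close>
  have "h \<circ> h = id"
  proof (rule triv)
    show "h \<circ> h \<in> Alt 6"
      using h alt_group_carrier'[OF h] by (auto simp: alt_group_carrier permutes_compose evenperm_comp)
    show "(h \<circ> h) ` A = A" by (simp only: image_comp[symmetric] hA)
    show "\<phi> (h \<circ> h) ` B = B"
      by (simp only: hom[OF hS hS] image_comp[symmetric] hB \<open>\<phi> h ` B' = B\<close>)
  qed
  then have inv: "\<phi> h \<circ> \<phi> h = id" using hom[OF hS hS] map_id by simp
  obtain x y z where xyz: "B = {x, y, z}" "x \<noteq> y" "x \<noteq> z" "y \<noteq> z"
    using three(2) by (auto simp: card_3_iff)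
  have "B \<union> \<phi> h ` B = {1..6}" "B \<inter> \<phi> h ` B = {}"
    using hB sub(2) unfolding B'_def by blast+
  then have "\<not> evenperm (\<phi> h)"
    using permutes[OF hS] inv xyz(2-) unfolding xyz(1) by (intro odd_if_swaps_halves[of "\<phi> h" x y z]) simp_all
  then show False using even_image[OF h] by (simp add: alt_group_carrier)
qed

text \<open>\<open>R\<close> consists of the least elements of the orbits. A \<open>q\<close> that
  preserves \<open>R\<close> maps each of them to a representative of the same orbit, hence fixes
  it; since \<open>q\<close> commutes with \<open>K\<close>, it fixes the rest of the orbit as
  well.\<close>

lemma abelian_transversal:
  assumes one: "id \<in> K" and comp: "\<And>k l. k \<in> K \<Longrightarrow> l \<in> K \<Longrightarrow> k \<circ> l \<in> K"
    and inv: "\<And>k. k \<in> K \<Longrightarrow> Hilbert_Choice.inv k \<in> K"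
    and perm: "\<And>k. k \<in> K \<Longrightarrow> k permutes {1..n}"
    and comm: "\<And>k l. k \<in> K \<Longrightarrow> l \<in> K \<Longrightarrow> k \<circ> l = l \<circ> k"
  obtains R :: "nat set" where "\<And>q. q \<in> K \<Longrightarrow> (\<And>i. i \<in> {1..n} \<Longrightarrow> q i \<in> R \<longleftrightarrow> i \<in> R) \<Longrightarrow> q = id"
proof -
  define orb where "orb i = (\<lambda>k. k i) ` K" for i
  define r where "r i = (LEAST j. j \<in> orb i)" for i
  have "i \<in> orb i" for i using one by (auto simp: orb_def image_iff intro!: bexI[of _ id])
  then have r_orb: "r i \<in> orb i" for i unfolding r_def by (rule LeastI)
  have sub: "orb (k i) \<subseteq> orb i" if "k \<in> K" for k i
  proof
    fix y assume "y \<in> orb (k i)"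
    then obtain l where "l \<in> K" "y = (l \<circ> k) i" by (auto simp: orb_def)
    then show "y \<in> orb i" unfolding orb_def using comp that by blast
  qed
  have orb_eq: "orb (k i) = orb i" if k: "k \<in> K" for k i
    using sub[OF k, of i] sub[OF inv[OF k], of "k i"] permutes_inverses(2)[OF perm[OF k]] by auto
  then have r_eq: "r (k i) = r i" if "k \<in> K" for k i using that by (simp add: r_def)
  show ?thesis
  proof (rule that[of "{i. r i = i}"])
    fix q assume q: "q \<in> K" "\<And>i. i \<in> {1..n} \<Longrightarrow> q i \<in> {i. r i = i} \<longleftrightarrow> i \<in> {i. r i = i}"
    have fixed: "q i = i" if "i \<in> {1..n}" "r i = i" for i
      using q(2)[OF that(1)] that(2) r_eq[OF q(1), of i] by simp
    have "q i = i" if i: "i \<in> {1..n}" for i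
    proof -
      obtain k where k: "k \<in> K" "r i = k i" using r_orb[of i] by (auto simp: orb_def)
      have "k i \<in> {1..n}" using perm[OF k(1)] i by (simp only: permutes_in_image)
      moreover have "r (k i) = k i" using r_eq[OF k(1)] k(2) by simp
      ultimately have "q (k i) = k i" by (rule fixed)
      then have "k (q i) = k i" using fun_cong[OF comm[OF k(1) q(1)], of i] by simp
      then show ?thesis using permutes_inj[OF perm[OF k(1)]] by (auto dest: injD)
    qed
    then show "q = id" using permutes_not_in[OF perm[OF q(1)]] by (auto simp: fun_eq_iff)
  qed
qed

text \<open>A colouring with two colours is determined by the class of colour 0; this translates
  stabilisers of sets into stabilisers of colourings.\<close>

lemma preserves_if_image_eq:
  fixes a :: "nat \<Rightarrow> nat"
  assumes p: "p permutes {1..n}" and img: "p ` {i \<in> {1..n}. a i = 0} = {i \<in> {1..n}. a i = 0}"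
    and less: "\<And>i. i \<in> {1..n} \<Longrightarrow> a i < 2" and i: "i \<in> {1..n}"
  shows "a (p i) = a i"
proof -
  have pi: "p i \<in> {1..n}" using p i by (simp only: permutes_in_image)
  have "a (p i) = 0 \<longleftrightarrow> a i = 0"
  proof
    assume "a (p i) = 0"
    then have "p i \<in> p ` {i \<in> {1..n}. a i = 0}" using img pi by blast
    then show "a i = 0" using permutes_inj[OF p] by (auto dest: injD)
  next
    assume "a i = 0"
    then show "a (p i) = 0" using img i by blast
  qed
  then show ?thesis using less[OF i] less[OF pi] by linarith
qed

context
  fixes G \<phi> H
  assumes G: "index_two_complete 6 G"
    and aut: "\<phi> \<in> auto (sym_group 6)" and H: "Alt 6 \<subseteq> H" "H \<subseteq> Sym 6"
    and plus: "part_preserving 6 G = bip_perm ` Diag_twisted \<phi> H"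
begin

interpretation index_two_complete 6 G by (rule G)
interpretation sym_group_aut 6 \<phi> by unfold_locales (rule aut)

text \<open>The stabiliser \<open>E\<close> of the colouring \<open>12|34|56\<close> of the left part is abelian, so a transversal of the
  orbits of \<open>\<phi> ` E\<close> is preserved by the identity only. The third colour does not occur in
  the right part, which rules out elements interchanging the parts.\<close>

lemma distinguishing_number_Diag_twisted:
  "distinguishing_number (verts (complete_bipartite 6)) G = 3"
proof -
  define a where "a i = (i + 1) div 2" for i :: nat
  define E where "E = {h \<in> Sym 6. \<forall>i\<in>{1..6}. a (h i) = a i}"
  have E_Sym: "E \<subseteq> Sym 6" by (auto simp: E_def)
  have E_comp: "h \<circ> k \<in> E" if "h \<in> E" "k \<in> E" for h k
    using that by (auto simp: E_def sym_group_carrier permutes_compose permutes_in_image simp del: atLeastAtMost_iff)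
  have E_inv: "Hilbert_Choice.inv h \<in> E" if h: "h \<in> E" for h
  proof -
    have p: "h permutes {1..6}" using h by (simp add: E_def sym_group_carrier)
    have "a (Hilbert_Choice.inv h i) = a i" if "i \<in> {1..6}" for i
    proof -
      have "Hilbert_Choice.inv h i \<in> {1..6}" using permutes_inv[OF p] that by (simp only: permutes_in_image)
      then have "a (h (Hilbert_Choice.inv h i)) = a (Hilbert_Choice.inv h i)" using h by (simp add: E_def)
      then show ?thesis by (simp add: permutes_inverses(1)[OF p])
    qed
    then show ?thesis using permutes_inv[OF p] by (simp add: E_def sym_group_carrier)
  qed
  have E_comm: "h \<circ> k = k \<circ> h" if hk: "h \<in> E" "k \<in> E" for h k
  proof
    fix i
    have p: "h permutes {1..6}" "k permutes {1..6}" using hk by (auto simp: E_def sym_group_carrier)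
    show "(h \<circ> k) i = (k \<circ> h) i"
    proof (cases "i \<in> {1..6}")
      case True
      \<comment> \<open>\<open>j\<close> is the other point in the block of \<open>i\<close>.
        Elements of \<open>E\<close> either fix or exchange the two, and such maps commute.\<close>
      define j where "j = (if odd i then i + 1 else i - 1)"
      have j: "j \<in> {1..6}" "a j = a i" "j \<noteq> i"
        using True by (auto simp: j_def a_def elim!: oddE evenE)
      have two: "l = i \<or> l = j" if "a l = a i" "l \<in> {1..6}" for l
        using that True by (auto simp: a_def j_def elim!: oddE evenE)
      have "f i = i \<and> f j = j \<or> f i = j \<and> f j = i" if f: "f \<in> E" for f
      proof -
        have f': "f permutes {1..6}" "a (f i) = a i" "a (f j) = a i"
          using f True j by (auto simp: E_def sym_group_carrier)
        then have "f i \<in> {1..6}" "f j \<in> {1..6}" using True j(1) by (simp_all only: permutes_in_image)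
        with f' two have "f i = i \<or> f i = j" "f j = i \<or> f j = j" by blast+
        moreover have "f i \<noteq> f j" using permutes_inj[OF f'(1)] j(3) by (auto dest: injD)
        ultimately show ?thesis by auto
      qed
      from this[OF hk(1)] this[OF hk(2)] show ?thesis by auto
    qed (use p in \<open>simp add: permutes_not_in\<close>)
  qed
  obtain R where R: "\<And>q. q \<in> \<phi> ` E \<Longrightarrow> (\<And>i. i \<in> {1..6} \<Longrightarrow> q i \<in> R \<longleftrightarrow> i \<in> R) \<Longrightarrow> q = id"
  proof (rule abelian_transversal[of "\<phi> ` E" 6])
    show "id \<in> \<phi> ` E" using map_id by (intro image_eqI[of _ _ id]) (auto simp: E_def)
    show "k \<circ> l \<in> \<phi> ` E" if kl: "k \<in> \<phi> ` E" "l \<in> \<phi> ` E" for k l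
      using kl E_comp E_Sym hom by (smt (verit) image_iff subsetD)
    show "Hilbert_Choice.inv k \<in> \<phi> ` E" if "k \<in> \<phi> ` E" for k
      using that E_inv E_Sym map_inv by (smt (verit) image_iff subsetD)
    show "k permutes {1..6}" if "k \<in> \<phi> ` E" for k using that E_Sym permutes by blast
    show "k \<circ> l = l \<circ> k" if "k \<in> \<phi> ` E" "l \<in> \<phi> ` E" for k l
      using that E_comm E_Sym hom by (smt (verit) image_iff subsetD)
  next
    fix R assume "\<And>q. q \<in> \<phi> ` E \<Longrightarrow> (\<And>i. i \<in> {1..6} \<Longrightarrow> q i \<in> R \<longleftrightarrow> i \<in> R) \<Longrightarrow> q = id"
    then show thesis by (rule that)
  qed
  define b where "b i = (if i \<in> R then 1 else 2 :: nat)" for i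
  have "distinguishing_number (verts (complete_bipartite 6)) G = Suc 2"
  proof (rule distinguishing_number_eq_Suc[where f = "case_sum a b" and l = 1])
    show "case_sum a b x \<in> {1..<1 + Suc 2}" if "x \<in> both_parts 6" for x
      using that by (auto simp: a_def b_def elim!: both_parts_cases)
  next
    fix p q assume pq: "bip_perm (p, q) \<in> part_preserving 6 G" "p permutes {1..6}" "q permutes {1..6}"
      "\<And>i. i \<in> {1..6} \<Longrightarrow> case_sum a b (Inl (p i)) = case_sum a b (Inl i)"
      "\<And>i. i \<in> {1..6} \<Longrightarrow> case_sum a b (Inr (q i)) = case_sum a b (Inr i)"
    have q: "q = \<phi> p" using pq(1) by (auto simp: plus Diag_twisted_def)
    have p: "p \<in> E" using pq(2,4) by (simp add: E_def sym_group_carrier)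
    have "q = id"
    proof (rule R)
      show "q i \<in> R \<longleftrightarrow> i \<in> R" if "i \<in> {1..6}" for i
        using pq(5)[OF that] by (simp add: b_def split: if_splits)
    qed (use p q in blast)
    moreover from this have "p = id"
      using inj p q E_Sym map_id by (metis id_in_Sym inj_onD subsetD)
    ultimately show "p = id \<and> q = id" by simp
  next
    fix x assume x: "x \<in> G" "swaps_sides 6 x" "\<forall>y\<in>both_parts 6. case_sum a b (x y) = case_sum a b y"
    have "card {i \<in> {1..6}. a i = 3} \<le> card {i \<in> {1..6}. b i = 3}"
      using swap_preserving_card_le[OF mem_permutes[OF x(1)] x(2,3)] by simp
    also have "{i \<in> {1..6}. b i = 3} = {}" by (auto simp: b_def)
    finally have "{i \<in> {1..6}. a i = 3} = {}" by simp
    moreover have "5 \<in> {i \<in> {1..6}. a i = 3}" by (simp add: a_def)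
    ultimately show False by blast
  next
    fix a b :: "nat \<Rightarrow> nat"
    assume less: "\<And>i. i \<in> {1..6} \<Longrightarrow> a i < 2" "\<And>i. i \<in> {1..6} \<Longrightarrow> b i < 2"
    \<comment> \<open>The element lies in \<open>Alt 6 \<subseteq> H\<close>, which settles both
      choices of \<open>H\<close> together.\<close>
    obtain h where h: "h \<in> Alt 6" "h \<noteq> id" "h ` {i \<in> {1..6}. a i = 0} = {i \<in> {1..6}. a i = 0}"
      "\<phi> h ` {i \<in> {1..6}. b i = 0} = {i \<in> {1..6}. b i = 0}"
      by (rule ex_Alt6_preserving[OF aut, of "{i \<in> {1..6}. a i = 0}" "{i \<in> {1..6}. b i = 0}"]) blast+
    have hS: "h \<in> Sym 6" using h(1) Alt_imp_Sym by blast
    show "\<exists>g\<in>G. g \<noteq> id \<and> (\<forall>i\<in>{1..6}. case_sum a b (g (Inl i)) = a i \<and> case_sum a b (g (Inr i)) = b i)"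
    proof (rule ex_bip_perm_preserving)
      show "bip_perm (h, \<phi> h) \<in> part_preserving 6 G"
        using h(1) H(1) by (auto simp: plus Diag_twisted_def)
      show "a (h i) = a i" if "i \<in> {1..6}" for i
        using preserves_if_image_eq[OF _ h(3) less(1) that] hS by (simp add: sym_group_carrier)
      show "b (\<phi> h i) = b i" if "i \<in> {1..6}" for i
        using preserves_if_image_eq[OF permutes[OF hS] h(4) less(2) that] .
    qed (use h in simp)
  qed (rule not_plus_swaps)
  then show ?thesis by simp
qed

end

section \<open>The groups containing the square of the Klein four-group\<close>

lemma Sym4_eqI:
  assumes "g \<in> Sym 4" "h \<in> Sym 4" "g 1 = h 1" "g 2 = h 2" "g 3 = h 3"
  shows "g = h"
proof -
  have p: "g permutes {1..4}" "h permutes {1..4}" using assms by (auto simp: sym_group_carrier)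
  have "Hilbert_Choice.inv h \<circ> g permutes {1..4}" by (rule permutes_compose[OF p(1) permutes_inv[OF p(2)]])
  moreover have "(Hilbert_Choice.inv h \<circ> g) i = i" if "i \<in> {1..4} - {4}" for i
  proof -
    have "i \<in> {1, 2, 3}" using that by auto
    then have "g i = h i" using assms(3-) by auto
    then show ?thesis by (simp add: permutes_inverses(2)[OF p(2)])
  qed
  \<comment> \<open>The pair is degenerate: a permutation that fixes all points but one is the
    identity.\<close>
  ultimately have "Hilbert_Choice.inv h \<circ> g = id"
    using fixed_outside_pair[of "Hilbert_Choice.inv h \<circ> g" "{1..4}" 4 4] by auto
  then have "h \<circ> (Hilbert_Choice.inv h \<circ> g) = h" by simp
  then show "g = h" by (simp add: comp_assoc[symmetric] permutes_inv_o(1)[OF p(2)])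
qed

lemma atLeastAtMost_1_4: "{1..4::nat} = {1, 2, 3, 4}"
  by auto

text \<open>Fixed-point-free involutions of four points are determined by the image of 1. In this
  form invariance under conjugation is immediate, and a fixed point forces the identity.\<close>

lemma Klein4_iff:
  "v \<in> Klein4 \<longleftrightarrow> v \<in> Sym 4 \<and> v \<circ> v = id \<and> (v = id \<or> (\<forall>i\<in>{1..4}. v i \<noteq> i))"
proof
  assume "v \<in> Klein4"
  then consider "v = id" | "v = Transposition.transpose 1 2 \<circ> Transposition.transpose 3 4"
    | "v = Transposition.transpose 1 3 \<circ> Transposition.transpose 2 4"
    | "v = Transposition.transpose 1 4 \<circ> Transposition.transpose 2 3"
    unfolding Klein4_def by blast
  then show "v \<in> Sym 4 \<and> v \<circ> v = id \<and> (v = id \<or> (\<forall>i\<in>{1..4}. v i \<noteq> i))"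
  proof cases
    case 1
    then show ?thesis by simp
  qed (intro conjI disjI2; simp add: sym_group_carrier permutes_compose permutes_swap_id;
      simp add: atLeastAtMost_1_4 fun_eq_iff Transposition.transpose_def)+
next
  assume v: "v \<in> Sym 4 \<and> v \<circ> v = id \<and> (v = id \<or> (\<forall>i\<in>{1..4}. v i \<noteq> i))"
  show "v \<in> Klein4"
  proof (cases "v = id")
    case False
    with v have v: "v \<in> Sym 4" "\<And>i. v (v i) = i" "\<And>i. i \<in> {1..4} \<Longrightarrow> v i \<noteq> i"
      by (auto simp: fun_eq_iff)
    then have mem: "v i \<in> {1, 2, 3, 4}" if "i \<in> {1, 2, 3, 4}" for i
      using that permutes_in_image[of v "{1..4}" i] unfolding atLeastAtMost_1_4 sym_group_carrier by blast
    have inj: "v i = v j \<longleftrightarrow> i = j" for i j using v(2) by metis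
    have ne: "v 1 \<noteq> 1" "v 2 \<noteq> 2" "v 3 \<noteq> 3" using v(3) by auto
    have S: "Transposition.transpose a b \<circ> Transposition.transpose c d \<in> Sym 4"
      if "{a, b, c, d} \<subseteq> {1..4}" for a b c d
      using that by (auto simp: sym_group_carrier intro!: permutes_compose permutes_swap_id)
    consider "v 1 = 2" "v 2 = 1" | "v 1 = 3" "v 3 = 1" | "v 1 = 4" "v 4 = 1"
      using mem[of 1] ne v(2)[of 1] by auto
    then show ?thesis
    proof cases
      case 1
      then have "v 3 = 4" using mem[of 3] ne inj[of 3 1] inj[of 3 2] by auto
      with 1 have "v = Transposition.transpose 1 2 \<circ> Transposition.transpose 3 4"
        by (intro Sym4_eqI v S) (auto simp: Transposition.transpose_def)
      then show ?thesis by (simp add: Klein4_def)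
    next
      case 2
      then have "v 2 = 4" using mem[of 2] ne inj[of 2 1] inj[of 2 3] by auto
      with 2 have "v = Transposition.transpose 1 3 \<circ> Transposition.transpose 2 4"
        by (intro Sym4_eqI v S) (auto simp: Transposition.transpose_def)
      then show ?thesis by (simp add: Klein4_def)
    next
      case 3
      then have "v 2 = 3" using mem[of 2] ne inj[of 2 1] inj[of 2 4] by auto
      with 3 have "v = Transposition.transpose 1 4 \<circ> Transposition.transpose 2 3"
        using v(2)[of 2] by (intro Sym4_eqI v S) (auto simp: Transposition.transpose_def)
      then show ?thesis by (simp add: Klein4_def)
    qed
  qed (simp add: Klein4_def)
qed

lemma Klein4_Sym: "v \<in> Klein4 \<Longrightarrow> v \<in> Sym 4"
  by (simp add: Klein4_iff)

lemma Klein4_inv: "v \<in> Klein4 \<Longrightarrow> Hilbert_Choice.inv v = v"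
  unfolding Klein4_iff by (intro inv_unique_comp) auto

lemma id_in_Klein4: "id \<in> Klein4"
  by (simp add: Klein4_def)

lemma Klein4_transitive:
  assumes "i \<in> {1..4}"
  obtains v where "v \<in> Klein4" "v 4 = i"
proof -
  have "\<exists>v\<in>Klein4. v 4 = i"
    using assms unfolding atLeastAtMost_1_4 by (auto simp: Klein4_def)
  then show ?thesis using that by blast
qed

lemma Klein4_comp:
  assumes "v \<in> Klein4" "w \<in> Klein4"
  shows "v \<circ> w \<in> Klein4"
proof -
  let ?a = "Transposition.transpose 1 2 \<circ> Transposition.transpose (3::nat) 4"
  let ?b = "Transposition.transpose 1 3 \<circ> Transposition.transpose (2::nat) 4"
  let ?c = "Transposition.transpose 1 4 \<circ> Transposition.transpose (2::nat) 3"
  have "?a \<circ> ?a = id" "?b \<circ> ?b = id" "?c \<circ> ?c = id" "?a \<circ> ?b = ?c" "?b \<circ> ?a = ?c"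
    "?a \<circ> ?c = ?b" "?c \<circ> ?a = ?b" "?b \<circ> ?c = ?a" "?c \<circ> ?b = ?a"
    by (simp_all add: fun_eq_iff Transposition.transpose_def)
  with assms show ?thesis
    unfolding Klein4_def by (elim insertE emptyE) (simp_all only: id_comp comp_id insert_iff simp_thms)
qed

lemma Klein4_normal:
  assumes "v \<in> Klein4" "h \<in> Sym 4"
  shows "h \<circ> v \<circ> Hilbert_Choice.inv h \<in> Klein4"
proof -
  have p: "h permutes {1..4}" using assms by (simp add: sym_group_carrier)
  note io = permutes_inverses[OF p]
  have vv: "v (v i) = i" for i using assms(1) by (auto simp: Klein4_iff fun_eq_iff)
  have "h \<circ> v \<circ> Hilbert_Choice.inv h \<in> Sym 4"
    using assms(1) p permutes_inv[OF p] unfolding Klein4_iff sym_group_carrier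
    by (intro permutes_compose) auto
  moreover have "(h \<circ> v \<circ> Hilbert_Choice.inv h) \<circ> (h \<circ> v \<circ> Hilbert_Choice.inv h) = id"
    by (simp add: fun_eq_iff io vv)
  moreover have "h \<circ> v \<circ> Hilbert_Choice.inv h = id \<or> (\<forall>i\<in>{1..4}. (h \<circ> v \<circ> Hilbert_Choice.inv h) i \<noteq> i)"
  proof (cases "v = id")
    case True
    then show ?thesis by (simp add: fun_eq_iff io)
  next
    case False
    have "(h \<circ> v \<circ> Hilbert_Choice.inv h) i \<noteq> i" if i: "i \<in> {1..4}" for i
    proof
      assume "(h \<circ> v \<circ> Hilbert_Choice.inv h) i = i"
      then have "v (Hilbert_Choice.inv h i) = Hilbert_Choice.inv h i"
        using io by (metis comp_apply)
      moreover have "Hilbert_Choice.inv h i \<in> {1..4}"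
        using permutes_inv[OF p] i by (simp only: permutes_in_image)
      ultimately show False using assms(1) False unfolding Klein4_iff by blast
    qed
    then show ?thesis by blast
  qed
  ultimately show ?thesis unfolding Klein4_iff by blast
qed

text \<open>The components of each generator agree modulo the Klein four-group, and by normality
  this persists in products.\<close>

lemma gen_Klein4_Diag_coset:
  assumes H: "H \<subseteq> Sym 4" and pq: "(p, q) \<in> gen_in_SymSym 4 (Klein4 \<times> Klein4 \<union> Diag H)"
  shows "p \<in> Sym 4 \<and> q \<in> Sym 4 \<and> p \<circ> Hilbert_Choice.inv q \<in> Klein4"
proof -
  have gens: "p \<in> Sym 4 \<and> q \<in> Sym 4 \<and> p \<circ> Hilbert_Choice.inv q \<in> Klein4"
    if "(p, q) \<in> Klein4 \<times> Klein4 \<union> Diag H" for p q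
  proof (cases "p = q")
    case True
    then have "p \<in> Sym 4" using that H Klein4_Sym by (auto simp: Diag_twisted_def)
    then show ?thesis using True permutes_inv_o(1)[of p "{1..4}"] id_in_Klein4 by (simp add: sym_group_carrier)
  next
    case False
    then have "p \<in> Klein4" "q \<in> Klein4" using that by (auto simp: Diag_twisted_def)
    then show ?thesis by (simp only: Klein4_Sym Klein4_inv Klein4_comp simp_thms)
  qed
  show ?thesis
    using pq[unfolded gen_in_SymSym_def]
  proof (induction "(p, q)" arbitrary: p q rule: generate.induct)
    case one
    then have "p = id" "q = id" by (simp_all add: DirProd_def sym_group_one)
    then show ?case by (simp only: id_in_Sym inv_id comp_id id_in_Klein4)
  next
    case (incl p q)
    then show ?case using gens by blast
  next
    case (inv h p q)
    obtain p' q' where h: "h = (p', q')" by (cases h)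
    have pq': "p' \<in> Sym 4" "q' \<in> Sym 4" "p' \<circ> Hilbert_Choice.inv q' \<in> Klein4"
      and pq'_cases: "p' \<in> Klein4 \<and> q' \<in> Klein4 \<or> p' = q'"
      using inv(1) gens[of p' q'] by (auto simp: h Diag_twisted_def)
    have "p = Hilbert_Choice.inv p'" "q = Hilbert_Choice.inv q'"
      using inv(2) pq' by (simp_all add: h inv_DirProd sym_group_is_group)
    \<comment> \<open>\<open>generate\<close> inverts generators only, so the two kinds are checked
      directly.\<close>
    moreover have "Hilbert_Choice.inv p' \<circ> Hilbert_Choice.inv (Hilbert_Choice.inv q') \<in> Klein4"
      using pq'_cases
    proof
      assume "p' \<in> Klein4 \<and> q' \<in> Klein4"
      then show ?thesis by (simp add: Klein4_inv Klein4_comp del: o_apply)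
    next
      assume "p' = q'"
      then show ?thesis
        using sym_group_inv_closed[OF pq'(1)] permutes_inv_o(1)[of "Hilbert_Choice.inv p'" "{1..4}"] id_in_Klein4
        by (simp add: sym_group_carrier)
    qed
    ultimately show ?case using pq' sym_group_inv_closed by blast
  next
    case (eng h1 h2 p q)
    obtain p1 q1 p2 q2 where h: "h1 = (p1, q1)" "h2 = (p2, q2)" by (metis surj_pair)
    have 1: "p1 \<in> Sym 4" "q1 \<in> Sym 4" "p1 \<circ> Hilbert_Choice.inv q1 \<in> Klein4" using eng(2)[OF h(1)] by auto
    have 2: "p2 \<in> Sym 4" "q2 \<in> Sym 4" "p2 \<circ> Hilbert_Choice.inv q2 \<in> Klein4" using eng(4)[OF h(2)] by auto
    have q: "q1 permutes {1..4}" "q2 permutes {1..4}" using 1 2 by (auto simp: sym_group_carrier)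
    have eq: "p = p1 \<circ> p2" "q = q1 \<circ> q2" using eng(5) by (auto simp: h DirProd_def sym_group_mult)
    have "p \<circ> Hilbert_Choice.inv q = (p1 \<circ> Hilbert_Choice.inv q1)
        \<circ> (q1 \<circ> (p2 \<circ> Hilbert_Choice.inv q2) \<circ> Hilbert_Choice.inv q1)"
      by (simp add: eq fun_eq_iff o_inv_distrib[OF permutes_bij[OF q(1)] permutes_bij[OF q(2)]]
          permutes_inverses[OF q(1)])
    also have "\<dots> \<in> Klein4" by (intro Klein4_comp Klein4_normal 1 2)
    finally show ?case using 1 2 by (simp add: eq sym_group_carrier permutes_compose)
  qed
qed

text \<open>Two classes of size 2 are preserved by the double transposition acting within them, a
  constant colouring by everything; sizes 3 and 1 give the second alternative.\<close>

lemma two_colouring_of_four_points: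
  fixes a :: "nat \<Rightarrow> nat"
  assumes "\<And>i. i \<in> {1..4} \<Longrightarrow> a i < 2"
  shows "(\<exists>v\<in>Klein4. v \<noteq> id \<and> (\<forall>i\<in>{1..4}. a (v i) = a i)) \<or> (\<exists>k\<in>{1..4}. \<exists>x. \<forall>i\<in>{1..4} - {k}. a i = x)"
    (is "?V \<or> ?K")
proof -
  have V: ?V if "v \<in> Klein4" "v 1 \<noteq> 1" "\<forall>i\<in>{1, 2, 3, 4}. a (v i) = a i" for v
    using that unfolding atLeastAtMost_1_4 by (metis id_apply)
  have "a 1 < 2" "a 2 < 2" "a 3 < 2" "a 4 < 2" using assms by auto
  then have "a 1 \<in> {0, 1}" "a 2 \<in> {0, 1}" "a 3 \<in> {0, 1}" "a 4 \<in> {0, 1}" by auto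
  then consider "a 1 = a 2" "a 3 = a 4" | "a 1 = a 3" "a 2 = a 4" | "a 1 = a 4" "a 2 = a 3"
    | "a 2 = a 1" "a 3 = a 1" | "a 2 = a 1" "a 4 = a 1" | "a 3 = a 1" "a 4 = a 1" | "a 3 = a 2" "a 4 = a 2"
    by auto
  then show ?thesis
  proof cases
    case 1
    then have ?V by (intro V[of "Transposition.transpose 1 2 \<circ> Transposition.transpose 3 4"])
      (auto simp: Klein4_def)
    then show ?thesis ..
  next
    case 2
    then have ?V by (intro V[of "Transposition.transpose 1 3 \<circ> Transposition.transpose 2 4"])
      (auto simp: Klein4_def)
    then show ?thesis ..
  next
    case 3
    then have ?V by (intro V[of "Transposition.transpose 1 4 \<circ> Transposition.transpose 2 3"])
      (auto simp: Klein4_def)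
    then show ?thesis ..
  next
    case 4
    then have ?K unfolding atLeastAtMost_1_4 by (intro bexI[of _ 4] exI[of _ "a 1"]) auto
    then show ?thesis ..
  next
    case 5
    then have ?K unfolding atLeastAtMost_1_4 by (intro bexI[of _ 3] exI[of _ "a 1"]) auto
    then show ?thesis ..
  next
    case 6
    then have ?K unfolding atLeastAtMost_1_4 by (intro bexI[of _ 2] exI[of _ "a 1"]) auto
    then show ?thesis ..
  next
    case 7
    then have ?K unfolding atLeastAtMost_1_4 by (intro bexI[of _ 1] exI[of _ "a 2"]) auto
    then show ?thesis ..
  qed
qed

text \<open>A colouring of four points with two colours that is not preserved by an element of the Klein
  four-group singles out one point \<open>k\<close>. Conjugating a fixed three-cycle by elements of the
  Klein four-group gives a three-cycle fixing the point singled out in each part.\<close>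

lemma gen_Klein4_Diag_preserving:
  fixes a b :: "nat \<Rightarrow> nat"
  assumes H: "Alt 4 \<subseteq> H"
    and less: "\<And>i. i \<in> {1..4} \<Longrightarrow> a i < 2" "\<And>i. i \<in> {1..4} \<Longrightarrow> b i < 2"
  obtains p q where "(p, q) \<in> gen_in_SymSym 4 (Klein4 \<times> Klein4 \<union> Diag H)" "p \<noteq> id \<or> q \<noteq> id"
    "\<forall>i\<in>{1..4}. a (p i) = a i" "\<forall>i\<in>{1..4}. b (q i) = b i"
proof -
  let ?gen = "gen_in_SymSym 4 (Klein4 \<times> Klein4 \<union> Diag H)"
  have klein: "(v, w) \<in> ?gen" if "v \<in> Klein4" "w \<in> Klein4" for v w
    using that unfolding gen_in_SymSym_def by (intro generate.incl) blast
  consider v where "v \<in> Klein4" "v \<noteq> id" "\<forall>i\<in>{1..4}. a (v i) = a i"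
    | v where "v \<in> Klein4" "v \<noteq> id" "\<forall>i\<in>{1..4}. b (v i) = b i"
    | k x l y where "k \<in> {1..4}" "\<forall>i\<in>{1..4} - {k}. a i = x" "l \<in> {1..4}" "\<forall>i\<in>{1..4} - {l}. b i = y"
    using two_colouring_of_four_points[of a, OF less(1)] two_colouring_of_four_points[of b, OF less(2)]
    by blast
  then show ?thesis
  proof cases
    case (1 v)
    with klein id_in_Klein4 show ?thesis by (intro that[of v id]) auto
  next
    case (2 v)
    with klein id_in_Klein4 show ?thesis by (intro that[of id v]) auto
  next
    case (3 k x l y)
    define c where "c = Transposition.transpose 1 2 \<circ> Transposition.transpose 2 (3 :: nat)"
    have c: "c \<in> Alt 4" "c 4 = 4" "c 1 = 2"
      by (auto simp: c_def alt_group_carrier evenperm_comp evenperm_swap permutation_swap_id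
          intro!: permutes_compose permutes_swap_id)
    have conj: "v \<circ> c \<circ> v \<noteq> id" "f ((v \<circ> c \<circ> v) i) = f i"
      if v: "v \<in> Klein4" "v 4 = k" and k: "\<forall>i\<in>{1..4} - {k}. f i = x" and i: "i \<in> {1..4}"
      for v i k x and f :: "nat \<Rightarrow> nat"
    proof -
      have vv: "v (v j) = j" for j using v(1) by (auto simp: Klein4_iff fun_eq_iff)
      have p: "v \<circ> c \<circ> v permutes {1..4}"
        using Klein4_Sym[OF v(1)] c(1) by (auto simp: sym_group_carrier alt_group_carrier intro!: permutes_compose)
      have "(v \<circ> c \<circ> v) (v 1) = v 2" using c(3) by (simp add: vv)
      moreover have "v 2 \<noteq> v 1" using vv by (metis one_eq_numeral_iff semiring_norm(85))
      ultimately show "v \<circ> c \<circ> v \<noteq> id" by (metis id_apply)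
      have fixed: "(v \<circ> c \<circ> v) k = k" using vv[of 4] v(2) c(2) by simp
      show "f ((v \<circ> c \<circ> v) i) = f i"
      proof (cases "i = k")
        case False
        then have "(v \<circ> c \<circ> v) i \<noteq> k" using fixed permutes_inj[OF p] by (metis injD)
        moreover have "(v \<circ> c \<circ> v) i \<in> {1..4}" using p i by (simp only: permutes_in_image)
        ultimately show ?thesis using k i False by (metis DiffI singletonD)
      qed (use fixed in simp)
    qed
    obtain v w where v: "v \<in> Klein4" "v 4 = k" and w: "w \<in> Klein4" "w 4 = l"
      using Klein4_transitive 3(1,3) by metis
    \<comment> \<open>As \<open>c\<close> is even, \<open>(c, c)\<close> lies in
      \<open>Diag H\<close>. The two components are conjugated independently, since the points
      singled out in the two parts may differ; \<open>v\<close> and \<open>w\<close> are their own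
      inverses.\<close>
    have "(v \<circ> c \<circ> v, w \<circ> c \<circ> w) = (v, w) \<otimes>\<^bsub>DirProd (sym_group 4) (sym_group 4)\<^esub> (c, c)
        \<otimes>\<^bsub>DirProd (sym_group 4) (sym_group 4)\<^esub> (v, w)"
      by (simp add: DirProd_def sym_group_mult)
    also have "\<dots> \<in> ?gen"
      using klein[OF v(1) w(1)] H c(1) unfolding gen_in_SymSym_def
      by (intro generate.eng) (auto simp: Diag_twisted_def intro: generate.incl)
    finally have "(v \<circ> c \<circ> v, w \<circ> c \<circ> w) \<in> ?gen" .
    then show ?thesis
    proof (rule that)
      show "v \<circ> c \<circ> v \<noteq> id \<or> w \<circ> c \<circ> w \<noteq> id" using conj(1)[OF v 3(2) 3(1)] by blast
      show "\<forall>i\<in>{1..4}. a ((v \<circ> c \<circ> v) i) = a i" by (intro ballI conj(2)[OF v 3(2)])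
      show "\<forall>i\<in>{1..4}. b ((w \<circ> c \<circ> w) i) = b i" by (intro ballI conj(2)[OF w 3(4)])
    qed
  qed
qed

context
  fixes G H
  assumes G: "index_two_complete 4 G"
    and H: "Alt 4 \<subseteq> H" "H \<subseteq> Sym 4"
    and plus: "part_preserving 4 G = bip_perm ` gen_in_SymSym 4 (Klein4 \<times> Klein4 \<union> Diag H)"
begin

interpretation index_two_complete 4 G by (rule G)

lemma distinguishing_number_gen_Klein4_Diag:
  "distinguishing_number (verts (complete_bipartite 4)) G = 3"
proof -
  \<comment> \<open>The colours are 1, 1, 2, 3 on the left and 1, 3, 2, 3 on the right. The
    symmetries are the transpositions of 1, 2 and of 2, 4, chosen different but with the common
    fixed point 3; disjoint ones would have their product in the Klein four-group. Colour 1 occurs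
    twice on the left and once on the right.\<close>
  define a where "a i = (if i = 1 then 1 else i - 1)" for i :: nat
  define b where "b i = (if i = 2 then 3 else if i = 3 then 2 else if i = 4 then 3 else 1 :: nat)" for i :: nat
  have "distinguishing_number (verts (complete_bipartite 4)) G = Suc 2"
  proof (rule distinguishing_number_eq_Suc[where f = "case_sum a b" and l = 1])
    show "case_sum a b x \<in> {1..<1 + Suc 2}" if "x \<in> both_parts 4" for x
      using that by (auto simp: a_def b_def elim!: both_parts_cases)
  next
    fix p q assume pq: "bip_perm (p, q) \<in> part_preserving 4 G" "p permutes {1..4}" "q permutes {1..4}"
      "\<And>i. i \<in> {1..4} \<Longrightarrow> case_sum a b (Inl (p i)) = case_sum a b (Inl i)"
      "\<And>i. i \<in> {1..4} \<Longrightarrow> case_sum a b (Inr (q i)) = case_sum a b (Inr i)"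
    have p: "p = id \<or> p = Transposition.transpose 1 2"
    proof (rule preserving_almost_injective[OF pq(2), where f = a])
      show "inj_on a ({1..4} - {1})" by (auto simp: inj_on_def a_def)
    qed (use pq(4) in \<open>simp_all add: a_def\<close>)
    have q: "q = id \<or> q = Transposition.transpose 2 4"
    proof (rule preserving_almost_injective[OF pq(3), where f = b])
      show "inj_on b ({1..4} - {2})" by (auto simp: inj_on_def b_def atLeastAtMost_1_4)
    qed (use pq(5) in \<open>simp_all add: b_def\<close>)
    have "p \<circ> Hilbert_Choice.inv q \<in> Klein4"
      using gen_Klein4_Diag_coset[OF H(2), of p q] pq(1) by (simp add: plus)
    moreover have "(p \<circ> Hilbert_Choice.inv q) 3 = 3"
      using p q by auto
    moreover have "(3 :: nat) \<in> {1..4}" by simp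
    ultimately have "p \<circ> Hilbert_Choice.inv q = id" unfolding Klein4_iff by blast
    then have "p \<circ> Hilbert_Choice.inv q \<circ> q = q" by simp
    then have "p = q" by (simp add: comp_assoc permutes_inv_o(2)[OF pq(3)])
    moreover have "Transposition.transpose 1 2 \<noteq> Transposition.transpose 2 (4 :: nat)"
      by (metis transpose_apply_first transpose_apply_other num.distinct(1) numeral_eq_iff one_eq_numeral_iff)
    ultimately show "p = id \<and> q = id" using p q by auto
  next
    fix x assume x: "x \<in> G" "swaps_sides 4 x" "\<forall>y\<in>both_parts 4. case_sum a b (x y) = case_sum a b y"
    have "card {i \<in> {1..4}. a i = 1} \<le> card {i \<in> {1..4}. b i = 1}"
      using swap_preserving_card_le[OF mem_permutes[OF x(1)] x(2,3)] by simp
    also have "{i \<in> {1..4}. a i = 1} = {1, 2}" by (auto simp: a_def)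
    also have "{i \<in> {1..4}. b i = 1} = {1}" by (auto simp: b_def)
    finally show False by simp
  next
    fix a b :: "nat \<Rightarrow> nat"
    assume less: "\<And>i. i \<in> {1..4} \<Longrightarrow> a i < 2" "\<And>i. i \<in> {1..4} \<Longrightarrow> b i < 2"
    obtain p q where "(p, q) \<in> gen_in_SymSym 4 (Klein4 \<times> Klein4 \<union> Diag H)" "p \<noteq> id \<or> q \<noteq> id"
      "\<forall>i\<in>{1..4}. a (p i) = a i" "\<forall>i\<in>{1..4}. b (q i) = b i"
      by (rule gen_Klein4_Diag_preserving[OF H(1) less]) blast
    then show "\<exists>g\<in>G. g \<noteq> id \<and> (\<forall>i\<in>{1..4}. case_sum a b (g (Inl i)) = a i \<and> case_sum a b (g (Inr i)) = b i)"
      by (intro ex_bip_perm_preserving[of p q]) (simp_all only: plus bip_perm_image_iff)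
  qed (rule not_plus_swaps)
  then show ?thesis by simp
qed

end

theorem theorem1p2:
  fixes n :: nat
    and \<Gamma> :: "(nat + nat) sgraph"
    and G Gplus :: "(nat + nat \<Rightarrow> nat + nat) set"
  assumes Gamma: "\<Gamma> = complete_bipartite n \<or> \<Gamma> = crown n"
    and G: "subgroup G (Aut \<Gamma>)"
    and Gplus: "Gplus = part_preserving n G"
    and index_two: "card (rcosets\<^bsub>Aut \<Gamma>\<lparr>carrier := G\<rparr>\<^esub> Gplus) = 2"
  shows
    "(\<Gamma> = complete_bipartite n \<and> n \<ge> 3 \<and> Gplus = bip_perm ` (Alt n \<times> Alt n)
        \<longrightarrow> distinguishing_number (verts \<Gamma>) G = n - 1) \<and>
     (\<Gamma> = complete_bipartite n \<and> n \<ge> 2 \<and>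
        Gplus = bip_perm ` gen_in_SymSym n (Alt n \<times> Alt n \<union> {(Transposition.transpose 1 2, Transposition.transpose 1 2)})
        \<longrightarrow> distinguishing_number (verts \<Gamma>) G = n) \<and>
     (\<Gamma> = complete_bipartite n \<and> Gplus = bip_perm ` (Sym n \<times> Sym n)
        \<longrightarrow> distinguishing_number (verts \<Gamma>) G = n + 1) \<and>
     (\<Gamma> = crown n \<and> Gplus = bip_perm ` Diag (Sym n)
        \<longrightarrow> int (distinguishing_number (verts \<Gamma>) G) = \<lfloor>sqrt (real n)\<rfloor> + 1) \<and>
     (\<Gamma> = crown n \<and> n \<ge> 3 \<and> Gplus = bip_perm ` Diag (Alt n)
        \<longrightarrow> int (distinguishing_number (verts \<Gamma>) G) = \<lceil>sqrt (real n - 1)\<rceil>) \<and>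
     (\<forall>\<phi> H. \<Gamma> = complete_bipartite n \<and> n = 6 \<and> outer_involution (sym_group 6) \<phi> \<and>
        H \<in> {Alt 6, Sym 6} \<and> Gplus = bip_perm ` Diag_twisted \<phi> H
        \<longrightarrow> distinguishing_number (verts \<Gamma>) G = 3) \<and>
     (\<forall>H. \<Gamma> = complete_bipartite n \<and> n = 4 \<and>
        H \<in> {Alt 4, Sym 4} \<and> Gplus = bip_perm ` gen_in_SymSym 4 (Klein4 \<times> Klein4 \<union> Diag H)
        \<longrightarrow> distinguishing_number (verts \<Gamma>) G = 3)"
proof -
  have verts: "verts \<Gamma> = both_parts n"
    using Gamma by (auto simp: both_parts_def crown_def complete_bipartite_def)
  have loc: "index_two n \<Gamma> G"
    by (rule index_two.intro[OF verts G]) (use index_two Gplus in simp)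
  have complete: "index_two_complete n G" if "\<Gamma> = complete_bipartite n"
    using loc that by (simp add: index_two_complete_def)
  have crown: "index_two_crown n G" if "\<Gamma> = crown n"
    using loc that by (simp add: index_two_crown_def)
  have Alt_subset_Sym: "Alt m \<subseteq> Sym m" for m using Alt_imp_Sym by blast
  show ?thesis
  proof (intro conjI allI impI; elim conjE)
    assume *: "\<Gamma> = complete_bipartite n" "n \<ge> 3" "Gplus = bip_perm ` (Alt n \<times> Alt n)"
    show "distinguishing_number (verts \<Gamma>) G = n - 1"
      using index_two_complete.distinguishing_number_Alt_Alt[OF complete] * Gplus by simp
  next
    assume *: "\<Gamma> = complete_bipartite n" "n \<ge> 2" "Gplus = bip_perm ` gen_in_SymSym n
      (Alt n \<times> Alt n \<union> {(Transposition.transpose 1 2, Transposition.transpose 1 2)})"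
    show "distinguishing_number (verts \<Gamma>) G = n"
      using index_two_complete.distinguishing_number_gen_Alt_Alt[OF complete] * Gplus by simp
  next
    assume *: "\<Gamma> = complete_bipartite n" "Gplus = bip_perm ` (Sym n \<times> Sym n)"
    show "distinguishing_number (verts \<Gamma>) G = n + 1"
      using index_two_complete.distinguishing_number_Sym_Sym[OF complete] * Gplus by simp
  next
    assume *: "\<Gamma> = crown n" "Gplus = bip_perm ` Diag (Sym n)"
    show "int (distinguishing_number (verts \<Gamma>) G) = \<lfloor>sqrt (real n)\<rfloor> + 1"
      using index_two_crown.distinguishing_number_Diag_Sym[OF crown] * Gplus by simp
  next
    assume *: "\<Gamma> = crown n" "n \<ge> 3" "Gplus = bip_perm ` Diag (Alt n)"
    show "int (distinguishing_number (verts \<Gamma>) G) = \<lceil>sqrt (real n - 1)\<rceil>"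
      using index_two_crown.distinguishing_number_Diag_Alt[OF crown] * Gplus by simp
  next
    fix \<phi> H
    assume *: "\<Gamma> = complete_bipartite n" "n = 6" "outer_involution (sym_group 6) \<phi>"
      "H \<in> {Alt 6, Sym 6}" "Gplus = bip_perm ` Diag_twisted \<phi> H"
    have "\<phi> \<in> auto (sym_group 6)" using *(3) by (simp add: outer_involution_def)
    moreover have "Alt 6 \<subseteq> H" "H \<subseteq> Sym 6" using *(4) Alt_subset_Sym by auto
    ultimately show "distinguishing_number (verts \<Gamma>) G = 3"
      using distinguishing_number_Diag_twisted[of G \<phi> H] complete * Gplus by simp
  next
    fix H
    assume *: "\<Gamma> = complete_bipartite n" "n = 4" "H \<in> {Alt 4, Sym 4}"
      "Gplus = bip_perm ` gen_in_SymSym 4 (Klein4 \<times> Klein4 \<union> Diag H)"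
    have "Alt 4 \<subseteq> H" "H \<subseteq> Sym 4" using *(3) Alt_subset_Sym by auto
    then show "distinguishing_number (verts \<Gamma>) G = 3"
      using distinguishing_number_gen_Klein4_Diag[of G H] complete * Gplus by simp
  qed
qed

end
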